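(* The value function $$v(t,y)=\inf_{\omega\in\hat{\mathcal U}}\max\Bigl(v_0(X_y^\omega(T)),\ \sup_{\theta\in(t,T)}g(X_y^\omega(\theta))\Bigr)$$ is the unique continuous viscosity solution of the Hamilton-Jacobi-Bellman equation $$\begin{cases}\min\bigl\{-\partial_t v(t,y)+H(y,\nabla v(t,y)),\ v(t,y)-g(y)\bigr\}=0, & t\in(0,T),\ y\in\Omega,\\ v(T,y)=\max(v_0(y),g(y)), & y\in\Omega,\end{cases}$$ where, for $X=(P,I)$ and $\zeta=(\zeta_1,\zeta_2)$, $$H(X,\zeta)=\max_{\omega\in\mathbb{U}}-\langle f(X,\omega),\zeta\rangle=(\theta I-P)\zeta_2+(\beta I+\gamma P)\zeta_1+\max\bigl\{(\zeta_2-\alpha\zeta_1)\,\rho\bar U(a-b\underline p+cq),\,0\bigr\}.$$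
   Context: State space $\Omega=\mathbb{R}^2_+$, states $X=(P,I)$; horizon $T>0$; $\nabla$ is the gradient in $y$. Constants: $a,b,c,\rho>0$; $\beta,\gamma,\theta\ge 0$ (in the dynamics and in $H$, $\theta$ is a constant; in suprema $\theta$ is a time variable); $\alpha>\gamma$; the quality level $q\ge0$ is a fixed constant. The control set is $\mathbb{U}=[\underline p,\bar p]\times[0,\bar U]$ with $0\le\underline p\le\bar p$, $\bar U\ge0$, and $\hat{\mathcal U}$ is the set of measurable functions $\omega=(p,U):[0,+\infty)\to\mathbb{U}$. The demand $\rho U(a-bp+cq)$ takes values in $\mathbb{R}_+$ for $(p,U)\in\mathbb{U}$; its largest value is attained at $(\underline p,\bar U)$. The dynamics is $$f(X,\omega)=\bigl(\alpha U\rho(a-bp+cq)-\beta I-\gamma P,\; P-\rho U(a-bp+cq)-\theta I\bigr),$$ and $X_y^\omega$ denotes the solution of $\dot X(s)=f(X(s),\omega(s))$ for $s\ge t$ with $X(t)=y$, where $t$ is the initial time under consideration. Constraint set and target: $\hat K=[P_{\min},P_{\max}]\times[I_{\min},I_{\max}]\subset\mathbb{R}^2_+$ and $C=[\tilde P,P_{\max}]\times[\tilde I,I_{\max}]$ with $\tilde P\in[P_{\min},P_{\max}]$, $\tilde I\in[I_{\min},I_{\max}]$ (nonempty closed sets). For a set $M$, $\mathrm d_M(x)=\inf\{|x-z|:z\in M\}$. The functions $g$ and $v_0$ are $$g(x)=\begin{cases}\mathrm d_{\hat K}(x), & x\notin\hat K,\\ -\mathrm d_{\Omega\setminus\hat K}(x),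 & x\in\hat K,\end{cases}\qquad v_0(x)=\begin{cases}\mathrm d_{C}(x), & x\notin C,\\ -\mathrm d_{\Omega\setminus C}(x), & x\in C,\end{cases}$$ and they are taken to be Lipschitz continuous with $g(x)\le0\Leftrightarrow x\in\hat K$ and $v_0(x)\le 0\Leftrightarrow x\in C$. At $t=T$ the value is read as $v(T,y)=\max(v_0(y),g(y))$.
   Formalization: Uniqueness on Ω alone fails because trajectories may leave Ω; it is proved among continuous viscosity solutions that agree with v on the boundary of Ω, and without boundary condition for the same problem posed on all of R². The functions g and v_0 are assumed Lipschitz on R². *)

theory Defs
  imports "HOL-Analysis.Analysis"
begin

text \<open>A state is a pair \<open>(P, I)\<close>, a control value is a pair \<open>(p, U)\<close>.\<close>

type_synonym state = "real \<times> real"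
type_synonym control = "real \<times> real"

text \<open>The demand is \<open>rho U (dem_a - dem_b p + dem_c qual)\<close>; the constraint set is
  \<open>[P_min, P_max] \<times> [I_min, I_max]\<close> and the target is \<open>[P_tgt, P_max] \<times> [I_tgt, I_max]\<close>.\<close>

record model =
  alpha :: real
  beta :: real
  gamma :: real
  theta :: real
  dem_a :: real
  dem_b :: real
  dem_c :: real
  rho :: real
  qual :: real
  p_lo :: real
  p_hi :: real
  U_max :: real
  horizon :: real
  P_min :: real
  P_max :: real
  I_min :: real
  I_max :: real
  P_tgt :: real
  I_tgt :: real

definition Omega :: "state set" where
  "Omega = {0..} \<times> {0..}"

definition controls :: "model \<Rightarrow> control set" where
  "controls M = {p_lo M..p_hi M} \<times> {0..U_max M}"

definition control_funs :: "model \<Rightarrow> (real \<Rightarrow> control) set" where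
  "control_funs M =
     {\<omega>. \<omega> \<in> borel_measurable (lebesgue_on {0..}) \<and> (\<forall>s\<ge>0. \<omega> s \<in> controls M)}"

definition demand :: "model \<Rightarrow> control \<Rightarrow> real" where
  "demand M \<omega> = rho M * snd \<omega> * (dem_a M - dem_b M * fst \<omega> + dem_c M * qual M)"

definition dyn :: "model \<Rightarrow> state \<Rightarrow> control \<Rightarrow> state" where
  "dyn M X \<omega> =
     (alpha M * demand M \<omega> - beta M * snd X - gamma M * fst X,
      fst X - demand M \<omega> - theta M * snd X)"

text \<open>Solutions are meant in the Caratheodory sense, since controls are only measurable.
  The case \<open>s = t\<close> is the initial condition \<open>X t = y\<close>.\<close>

definition solves :: "model \<Rightarrow> real \<Rightarrow> state \<Rightarrow> (real \<Rightarrow> control) \<Rightarrow> (real \<Rightarrow> state) \<Rightarrow> bool" where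
  "solves M t y \<omega> X \<longleftrightarrow>
     (\<forall>s\<ge>t. ((\<lambda>r. dyn M (X r) (\<omega> r)) has_integral (X s - y)) {t..s})"

text \<open>For \<open>t \<ge> 0\<close> and an admissible control, the solution exists and is unique on \<open>{t..}\<close>;
  its values before \<open>t\<close> are arbitrary and never used. It need not stay in \<open>Omega\<close>.\<close>

definition traj :: "model \<Rightarrow> real \<Rightarrow> state \<Rightarrow> (real \<Rightarrow> control) \<Rightarrow> real \<Rightarrow> state" where
  "traj M t y \<omega> = (SOME X. solves M t y \<omega> X)"

definition K_set :: "model \<Rightarrow> state set" where
  "K_set M = {P_min M..P_max M} \<times> {I_min M..I_max M}"

definition C_set :: "model \<Rightarrow> state set" where
  "C_set M = {P_tgt M..P_max M} \<times> {I_tgt M..I_max M}"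

definition signed_dist :: "state set \<Rightarrow> state \<Rightarrow> real" where
  "signed_dist S x = (if x \<in> S then - infdist x (Omega - S) else infdist x S)"

definition g_fun :: "model \<Rightarrow> state \<Rightarrow> real" where
  "g_fun M = signed_dist (K_set M)"

definition v0_fun :: "model \<Rightarrow> state \<Rightarrow> real" where
  "v0_fun M = signed_dist (C_set M)"

text \<open>At \<open>t = T\<close> the supremum would range over the empty set.\<close>

definition value_fun :: "model \<Rightarrow> real \<Rightarrow> state \<Rightarrow> real" where
  "value_fun M t y =
     (if t < horizon M
      then INF \<omega>\<in>control_funs M.
             max (v0_fun M (traj M t y \<omega> (horizon M)))
                 (SUP s\<in>{t<..<horizon M}. g_fun M (traj M t y \<omega> s))
      else max (v0_fun M y) (g_fun M y))"

definition hamiltonian :: "model \<Rightarrow> state \<Rightarrow> state \<Rightarrow> real" where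
  "hamiltonian M X \<zeta> = (SUP \<omega>\<in>controls M. - (dyn M X \<omega> \<bullet> \<zeta>))"

text \<open>\<open>\<phi>\<close> is continuously differentiable on the open set \<open>G\<close> of pairs \<open>(t, y)\<close>, with time
  derivative \<open>\<phi>t\<close> and gradient \<open>\<phi>y\<close> in \<open>y\<close>.\<close>

definition C1_test ::
  "(real \<times> state) set \<Rightarrow> (real \<times> state \<Rightarrow> real) \<Rightarrow> (real \<times> state \<Rightarrow> real) \<Rightarrow>
   (real \<times> state \<Rightarrow> state) \<Rightarrow> bool" where
  "C1_test G \<phi> \<phi>t \<phi>y \<longleftrightarrow>
     continuous_on G \<phi>t \<and> continuous_on G \<phi>y \<and>
     (\<forall>z\<in>G. (\<phi> has_derivative (\<lambda>h. \<phi>t z * fst h + \<phi>y z \<bullet> snd h)) (at z))"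

definition local_max_at :: "(real \<times> state \<Rightarrow> real) \<Rightarrow> real \<times> state \<Rightarrow> bool" where
  "local_max_at F z0 \<longleftrightarrow> (\<forall>\<^sub>F z in nhds z0. F z \<le> F z0)"

definition local_min_at :: "(real \<times> state \<Rightarrow> real) \<Rightarrow> real \<times> state \<Rightarrow> bool" where
  "local_min_at F z0 \<longleftrightarrow> (\<forall>\<^sub>F z in nhds z0. F z0 \<le> F z)"

definition viscosity_subsolution ::
  "model \<Rightarrow> (real \<times> state) set \<Rightarrow> (real \<Rightarrow> state \<Rightarrow> real) \<Rightarrow> bool" where
  "viscosity_subsolution M G w \<longleftrightarrow>
     (\<forall>\<phi> \<phi>t \<phi>y t y. C1_test G \<phi> \<phi>t \<phi>y \<and> (t, y) \<in> G \<and>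
        local_max_at (\<lambda>z. w (fst z) (snd z) - \<phi> z) (t, y) \<longrightarrow>
        min (- \<phi>t (t, y) + hamiltonian M y (\<phi>y (t, y))) (w t y - g_fun M y) \<le> 0)"

definition viscosity_supersolution ::
  "model \<Rightarrow> (real \<times> state) set \<Rightarrow> (real \<Rightarrow> state \<Rightarrow> real) \<Rightarrow> bool" where
  "viscosity_supersolution M G w \<longleftrightarrow>
     (\<forall>\<phi> \<phi>t \<phi>y t y. C1_test G \<phi> \<phi>t \<phi>y \<and> (t, y) \<in> G \<and>
        local_min_at (\<lambda>z. w (fst z) (snd z) - \<phi> z) (t, y) \<longrightarrow>
        min (- \<phi>t (t, y) + hamiltonian M y (\<phi>y (t, y))) (w t y - g_fun M y) \<ge> 0)"

text \<open>A continuous viscosity solution of the terminal value problem on a closed state domain \<open>D\<close>: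
  continuity and the terminal condition are required up to the boundary of \<open>D\<close>, the equation is
  tested at the interior points. For \<open>D = Omega\<close> this does not determine \<open>w\<close> by itself: trajectories
  may leave \<open>Omega\<close>, so the values on \<open>frontier Omega\<close> depend on data outside \<open>Omega\<close>. The
  problem is closed on \<open>Omega\<close> by these boundary values, and on \<open>D = UNIV\<close> without any.\<close>

definition hjb_solution :: "model \<Rightarrow> state set \<Rightarrow> (real \<Rightarrow> state \<Rightarrow> real) \<Rightarrow> bool" where
  "hjb_solution M D w \<longleftrightarrow>
     continuous_on ({0..horizon M} \<times> D) (\<lambda>z. w (fst z) (snd z)) \<and>
     viscosity_subsolution M ({0<..<horizon M} \<times> interior D) w \<and>
     viscosity_supersolution M ({0<..<horizon M} \<times> interior D) w \<and>
     (\<forall>y\<in>D. w (horizon M) y = max (v0_fun M y) (g_fun M y))"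

lemma signed_dist_nonpos_iff:
  assumes "closed S" "S \<noteq> {}"
  shows "signed_dist S x \<le> 0 \<longleftrightarrow> x \<in> S"
  using assms in_closed_iff_infdist_zero[of S x] infdist_nonneg[of x S]
    infdist_nonneg[of x "Omega - S"]
  by (auto simp: signed_dist_def)

lemma demand_le_max:
  assumes "dem_b M > 0" "rho M > 0" "p_lo M \<le> p_hi M"
    and nonneg: "\<And>\<omega>. \<omega> \<in> controls M \<Longrightarrow> 0 \<le> demand M \<omega>"
    and mem: "\<omega> \<in> controls M"
  shows "demand M \<omega> \<le> demand M (p_lo M, U_max M)"
proof -
  obtain p U where \<omega>: "\<omega> = (p, U)" by force
  have pU: "p_lo M \<le> p" "p \<le> p_hi M" "0 \<le> U" "U \<le> U_max M"
    using mem by (auto simp: controls_def \<omega>)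
  let ?r = "\<lambda>p. dem_a M - dem_b M * p + dem_c M * qual M"
  have mono: "?r p \<le> ?r (p_lo M)"
    using pU(1) assms(1) by simp
  show ?thesis
  proof (cases "U_max M = 0")
    case True
    then show ?thesis using pU by (simp add: demand_def \<omega>)
  next
    case False
    then have "U_max M > 0" using pU by simp
    moreover have "0 \<le> demand M (p_lo M, U_max M)"
      using assms(3) pU by (intro nonneg) (auto simp: controls_def)
    ultimately have "0 \<le> ?r (p_lo M)"
      using mult_pos_pos[OF assms(2), of "U_max M"]
      by (metis demand_def fst_conv snd_conv zero_le_mult_iff not_le)
    then have "U * ?r p \<le> U_max M * ?r (p_lo M)"
      using pU mono by (meson mult_left_mono mult_right_mono order_trans)
    then show ?thesis
      using assms(2) by (simp add: demand_def \<omega> mult.assoc)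
  qed
qed

end

theory Submission
  imports Defs
begin

text \<open>
The value function solves the equation because of dynamic programming, and it is the only solution
because sub- and supersolutions can be compared.

The dynamics is affine: a fixed linear map of the state, plus the demand times a fixed direction.
Trajectories therefore exist, are Lipschitz in the initial state and move with bounded speed,
uniformly in the control. Following one control up to a time \<open>s\<close> and another one afterwards is
again admissible. From these facts the dynamic programming principle follows in two halves,
\<open>value_le_along\<close> and \<open>value_less_along\<close>, and with it the local Lipschitz continuity of the value.
Both are derived from a description of the value by inequalities, \<open>value_le\<close> and
\<open>value_less_obtain\<close>, which avoids computing with suprema and infima.

For the viscosity inequalities, a test function that violates one of them changes at a definite
rate along the relevant trajectories for a short time (\<open>test_function_increases\<close>), which contradicts
one half of dynamic programming. For the subsolution inequality the relevant trajectory is that of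
one constant control that attains the Hamiltonian; for the supersolution inequality it is every
trajectory.

Comparison (\<open>comparison\<close>) is proved by doubling both time and state. The functions to be compared may
grow arbitrarily at infinity; the comparison is local because information travels with finite speed.
Indeed \<open>(1 + norm y ^ 2) * exp (- K * t)\<close> does not increase along all trajectories if \<open>K\<close> is large, so a penalty
that is a nondecreasing function of this quantity keeps the supersolution inequality and confines the
maximum to a compact set. Further penalties in time give strictness and keep the maximum away from
time \<open>0\<close>, where nothing is prescribed. On \<open>Omega\<close> the prescribed values exclude a maximum at the frontier; on the whole plane
there is no frontier.
\<close>

section \<open>The controlled dynamics and the Hamiltonian\<close>

definition lin_part :: "model \<Rightarrow> state \<Rightarrow> state" where
  "lin_part M X = (- beta M * snd X - gamma M * fst X, fst X - theta M * snd X)"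

definition input_dir :: "model \<Rightarrow> state" where
  "input_dir M = (alpha M, - 1)"

lemma dyn_affine: "dyn M X \<omega> = lin_part M X + demand M \<omega> *\<^sub>R input_dir M"
  by (simp add: dyn_def lin_part_def input_dir_def algebra_simps)

lemma bounded_linear_lin_part: "bounded_linear (lin_part M)"
proof -
  have "linear (lin_part M)"
    by (rule linearI) (auto simp: lin_part_def algebra_simps)
  then show ?thesis by (simp add: linear_conv_bounded_linear)
qed

lemmas lin_part_add = linear_add[OF bounded_linear.linear[OF bounded_linear_lin_part]]
lemmas lin_part_diff = linear_diff[OF bounded_linear.linear[OF bounded_linear_lin_part]]

text \<open>The velocity of any admissible motion at \<open>X\<close> has norm at most
  \<open>speed_slope M * norm X + speed_offset M\<close>; moreover \<open>speed_slope M\<close> is a Lipschitz constant of the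
  dynamics in the state. The offset uses that the demand is largest at the lowest price and full effort.\<close>

definition speed_slope :: "model \<Rightarrow> real" where
  "speed_slope M = onorm (lin_part M)"

definition speed_offset :: "model \<Rightarrow> real" where
  "speed_offset M = demand M (p_lo M, U_max M) * norm (input_dir M)"

lemma norm_lin_part: "norm (lin_part M X) \<le> speed_slope M * norm X"
  unfolding speed_slope_def by (rule onorm[OF bounded_linear_lin_part])

lemma speed_slope_nonneg: "0 \<le> speed_slope M"
  unfolding speed_slope_def by (rule onorm_pos_le[OF bounded_linear_lin_part])

lemma dyn_diff: "dyn M X \<omega> - dyn M Y \<omega> = lin_part M (X - Y)"
  by (simp add: dyn_affine lin_part_diff)

text \<open>A single Lipschitz constant serves both the constraint and the target function.\<close>

locale control_problem =
  fixes M :: model and Lip :: real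
  assumes price_coeff_pos: "dem_b M > 0" and rho_pos: "rho M > 0"
    and price_range: "p_lo M \<le> p_hi M" and effort_range: "0 \<le> U_max M"
    and horizon_pos: "horizon M > 0"
    and demand_nonneg: "\<And>\<omega>. \<omega> \<in> controls M \<Longrightarrow> demand M \<omega> \<ge> 0"
    and lipschitz_g: "Lip-lipschitz_on UNIV (g_fun M)"
    and lipschitz_v0: "Lip-lipschitz_on UNIV (v0_fun M)"
begin

lemma full_effort_mem: "(p_lo M, U_max M) \<in> controls M"
  using price_range effort_range by (simp add: controls_def)

lemma no_effort_mem: "(p_lo M, 0) \<in> controls M"
  using price_range effort_range by (simp add: controls_def)

lemma demand_bound: "\<omega> \<in> controls M \<Longrightarrow> demand M \<omega> \<le> demand M (p_lo M, U_max M)"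
  by (rule demand_le_max[OF price_coeff_pos rho_pos price_range demand_nonneg])

lemma speed_offset_nonneg: "0 \<le> speed_offset M"
  unfolding speed_offset_def using demand_nonneg[OF full_effort_mem] by simp

lemma norm_dyn:
  assumes "\<omega> \<in> controls M"
  shows "norm (dyn M X \<omega>) \<le> speed_slope M * norm X + speed_offset M"
proof -
  have "norm (demand M \<omega> *\<^sub>R input_dir M) \<le> speed_offset M"
    unfolding speed_offset_def norm_scaleR
    using demand_nonneg[OF assms] demand_bound[OF assms] by (intro mult_right_mono) auto
  then show ?thesis
    unfolding dyn_affine using norm_lin_part[of M X] norm_triangle_ineq[of "lin_part M X"]
    by (meson add_mono order_trans)
qed

text \<open>The control enters \<open>- (dyn M X \<omega> \<bullet> \<zeta>)\<close> only through the demand times \<open>\<zeta>\<^sub>2 - \<alpha> \<zeta>\<^sub>1\<close>. The demand ranges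
  between \<open>0\<close>, attained without effort, and its value at the lowest price and full effort, so one of
  these two controls is optimal, depending on the sign of that factor.\<close>

lemma hamiltonian_value:
  defines "h X \<zeta> \<equiv> (theta M * snd X - fst X) * snd \<zeta> + (beta M * snd X + gamma M * fst X) * fst \<zeta> +
     max ((snd \<zeta> - alpha M * fst \<zeta>) * rho M * U_max M *
       (dem_a M - dem_b M * p_lo M + dem_c M * qual M)) 0"
  shows "hamiltonian M X \<zeta> = h X \<zeta>"
    and "\<omega> \<in> controls M \<Longrightarrow> - (dyn M X \<omega> \<bullet> \<zeta>) \<le> hamiltonian M X \<zeta>"
    and "\<exists>\<omega>\<in>controls M. - (dyn M X \<omega> \<bullet> \<zeta>) = hamiltonian M X \<zeta>"
proof -
  let ?s = "snd \<zeta> - alpha M * fst \<zeta>" and ?d = "demand M (p_lo M, U_max M)"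
  have eq: "- (dyn M X \<omega> \<bullet> \<zeta>) = (theta M * snd X - fst X) * snd \<zeta>
      + (beta M * snd X + gamma M * fst X) * fst \<zeta> + demand M \<omega> * ?s" for \<omega>
    by (cases X, cases \<zeta>) (simp add: dyn_def algebra_simps)
  have h: "h X \<zeta> = (theta M * snd X - fst X) * snd \<zeta>
      + (beta M * snd X + gamma M * fst X) * fst \<zeta> + max (?d * ?s) 0"
    by (simp add: h_def demand_def algebra_simps)
  have up: "- (dyn M X \<omega> \<bullet> \<zeta>) \<le> h X \<zeta>" if "\<omega> \<in> controls M" for \<omega>
  proof -
    have "demand M \<omega> * ?s \<le> max (?d * ?s) 0"
    proof (cases "?s \<ge> 0")
      case True
      then show ?thesis
        using mult_right_mono[OF demand_bound[OF that] True] by simp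
    next
      case False
      then have "demand M \<omega> * ?s \<le> 0"
        using demand_nonneg[OF that] by (simp add: mult_nonneg_nonpos)
      then show ?thesis by simp
    qed
    then show ?thesis unfolding eq h by simp
  qed
  have at: "\<exists>\<omega>\<in>controls M. - (dyn M X \<omega> \<bullet> \<zeta>) = h X \<zeta>"
  proof (cases "?d * ?s \<ge> 0")
    case True
    then show ?thesis
      by (intro bexI[OF _ full_effort_mem]) (simp only: eq h max_absorb1)
  next
    case False
    have "demand M (p_lo M, 0) = 0" by (simp add: demand_def)
    with False show ?thesis
      by (intro bexI[OF _ no_effort_mem]) (simp add: eq h del: add_diff_cancel)
  qed
  show ham: "hamiltonian M X \<zeta> = h X \<zeta>"
    unfolding hamiltonian_def
  proof (rule cSup_eq_maximum)
    show "h X \<zeta> \<in> (\<lambda>\<omega>. - (dyn M X \<omega> \<bullet> \<zeta>)) ` controls M"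
      using at by (metis (mono_tags, lifting) image_eqI)
  qed (use up in auto)
  show "\<omega> \<in> controls M \<Longrightarrow> - (dyn M X \<omega> \<bullet> \<zeta>) \<le> hamiltonian M X \<zeta>"
    using up ham by simp
  show "\<exists>\<omega>\<in>controls M. - (dyn M X \<omega> \<bullet> \<zeta>) = hamiltonian M X \<zeta>"
    using at ham by simp
qed

end

section \<open>Trajectories\<close>

text \<open>For \<open>B\<^sup>2 = D\<close> the series \<open>exp (s B)\<close> is \<open>C s + S s B\<close>, where \<open>C\<close> and \<open>S\<close> are hyperbolic, polynomial or
  trigonometric functions according to the sign of \<open>D\<close>. The last identity says that \<open>C s - S s B\<close> is
  the inverse.\<close>

lemma exists_cosh_sinh_pair:
  fixes D :: real
  shows "\<exists>C S. C 0 = 1 \<and> S 0 = 0 \<and> (\<forall>s. (C has_real_derivative D * S s) (at s)) \<and>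
    (\<forall>s. (S has_real_derivative C s) (at s)) \<and> (\<forall>s. C s ^ 2 - D * S s ^ 2 = 1)"
proof -
  consider "D > 0" | "D = 0" | "D < 0" by linarith
  then show ?thesis
  proof cases
    case 1
    define k where "k = sqrt D"
    have k: "k > 0" "D = k * k" using 1 by (auto simp: k_def)
    show ?thesis
      using k
      by (intro exI[of _ "\<lambda>s. cosh (k * s)"] exI[of _ "\<lambda>s. sinh (k * s) / k"])
         (auto intro!: derivative_eq_intros simp: power_divide power2_eq_square cosh_square_eq[unfolded power2_eq_square])
  next
    case 2
    then show ?thesis
      by (intro exI[of _ "\<lambda>s. 1"] exI[of _ "\<lambda>s. s"]) (auto intro!: derivative_eq_intros)
  next
    case 3
    define k where "k = sqrt (- D)"
    have k: "k > 0" "D = - (k * k)" using 3 by (auto simp: k_def)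
    show ?thesis
      using k
      by (intro exI[of _ "\<lambda>s. cos (k * s)"] exI[of _ "\<lambda>s. sin (k * s) / k"])
         (auto intro!: derivative_eq_intros simp: power_divide power2_eq_square
           sin_cos_squared_add2[unfolded power2_eq_square])
  qed
qed

text \<open>The two-dimensional linear equation is solved by variation of constants with an explicit matrix
  exponential. Half the trace is split off, so that by Cayley-Hamilton the square of the remaining
  traceless map \<open>B\<close> is a scalar \<open>D\<close>.\<close>

lemma forced_linear_ode:
  fixes F :: "real \<Rightarrow> state"
  assumes F: "\<And>b. continuous_on {t..b} F"
  shows "\<exists>Y. Y t = y \<and> (\<forall>b. \<forall>s\<in>{t..b}.
    (Y has_vector_derivative lin_part M (Y s) + F s) (at s within {t..b}))"
proof -
  define l where "l = (gamma M + theta M) / 2"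
  define D where "D = l\<^sup>2 - (gamma M * theta M + beta M)"
  define B where "B x = lin_part M x + l *\<^sub>R x" for x
  have BB: "B (B x) = D *\<^sub>R x" for x
    by (simp add: B_def D_def lin_part_def l_def power2_eq_square prod_eq_iff)
       (auto simp: field_simps)
  have bl: "bounded_linear B"
    unfolding B_def by (intro bounded_linear_add bounded_linear_lin_part bounded_linear_scaleR_right)
  note B_lin = linear_add[OF bounded_linear.linear[OF bl]]
    linear_scale[OF bounded_linear.linear[OF bl]] linear_diff[OF bounded_linear.linear[OF bl]]
  obtain C S where CS: "C 0 = 1" "S 0 = 0" "\<And>s. (C has_real_derivative D * S s) (at s)"
    "\<And>s. (S has_real_derivative C s) (at s)" "\<And>s. C s ^ 2 - D * S s ^ 2 = 1"
    using exists_cosh_sinh_pair[of D] by blast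
  have cont: "continuous_on A C" "continuous_on A S" for A
    using CS(3,4) by (meson DERIV_continuous_on has_field_derivative_at_within)+
  \<comment> \<open>\<open>G r\<close> is \<open>F r\<close> pulled back to time \<open>t\<close> by the inverse flow.\<close>
  define G where "G r = exp (l * (r - t)) *\<^sub>R (C (r - t) *\<^sub>R F r - S (r - t) *\<^sub>R B (F r))" for r
  define z where "z s = y + integral {t..s} G" for s
  define Y where "Y s = exp (- l * (s - t)) *\<^sub>R (C (s - t) *\<^sub>R z s + S (s - t) *\<^sub>R B (z s))" for s
  have G: "continuous_on {t..b} G" for b
    unfolding G_def
    by (intro continuous_intros F bounded_linear.continuous_on[OF bl]
        continuous_on_compose2[OF cont(1)[of UNIV]] continuous_on_compose2[OF cont(2)[of UNIV]]) auto
  have Yd: "(Y has_vector_derivative lin_part M (Y s) + F s) (at s within {t..b})"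
    if s: "s \<in> {t..b}" for s b
  proof -
    have zd: "(z has_vector_derivative G s) (at s within {t..b})"
      unfolding z_def
      using has_vector_derivative_add[OF has_vector_derivative_const
          integral_has_vector_derivative[OF G s]] by simp
    have Bz: "((\<lambda>s. B (z s)) has_vector_derivative B (G s)) (at s within {t..b})"
      by (rule bounded_linear.has_vector_derivative[OF bl zd])
    have sd: "((\<lambda>s. s - t) has_real_derivative 1) (at s within {t..b})"
      by (auto intro!: derivative_eq_intros)
    have Cd: "((\<lambda>s. C (s - t)) has_real_derivative D * S (s - t)) (at s within {t..b})"
      using DERIV_chain2[OF CS(3) sd] by simp
    have Sd: "((\<lambda>s. S (s - t)) has_real_derivative C (s - t)) (at s within {t..b})"
      using DERIV_chain2[OF CS(4) sd] by simp
    have ed: "((\<lambda>s. exp (- l * (s - t))) has_real_derivative - l * exp (- l * (s - t))) (at s within {t..b})"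
      by (auto intro!: derivative_eq_intros)
    define c where "c = C (s - t)"
    define q where "q = S (s - t)"
    define e where "e = exp (- l * (s - t))"
    define e' where "e' = exp (l * (s - t))"
    have ee: "e * e' = 1" by (simp add: e_def e'_def mult_exp_exp)
    have cq: "c * c - D * (q * q) = 1" using CS(5)[of "s - t"] by (simp add: c_def q_def power2_eq_square)
    have Gs: "G s = e' *\<^sub>R (c *\<^sub>R F s - q *\<^sub>R B (F s))"
      by (simp add: G_def c_def q_def e'_def)
    have d: "(Y has_vector_derivative
        e *\<^sub>R ((c *\<^sub>R G s + (D * q) *\<^sub>R z s) + (q *\<^sub>R B (G s) + c *\<^sub>R B (z s)))
        + (- l * e) *\<^sub>R (c *\<^sub>R z s + q *\<^sub>R B (z s))) (at s within {t..b})"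
      unfolding Y_def c_def q_def e_def
      by (intro has_vector_derivative_scaleR ed Cd Sd zd Bz has_vector_derivative_add)
    have "c *\<^sub>R G s + q *\<^sub>R B (G s) = e' *\<^sub>R (c * c - D * (q * q)) *\<^sub>R F s"
      by (simp add: Gs B_lin BB algebra_simps)
    then have 1: "e *\<^sub>R (c *\<^sub>R G s + q *\<^sub>R B (G s)) = F s"
      unfolding cq using ee by simp
    have Ys: "Y s = e *\<^sub>R (c *\<^sub>R z s + q *\<^sub>R B (z s))"
      by (simp add: Y_def c_def q_def e_def)
    have "lin_part M (Y s) = B (Y s) - l *\<^sub>R Y s" by (simp add: B_def)
    also have "\<dots> = e *\<^sub>R ((D * q) *\<^sub>R z s + c *\<^sub>R B (z s)) + (- l * e) *\<^sub>R (c *\<^sub>R z s + q *\<^sub>R B (z s))"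
      by (simp add: Ys B_lin BB algebra_simps)
    finally have 2: "lin_part M (Y s) = \<dots>" .
    have "lin_part M (Y s) + F s =
        e *\<^sub>R ((c *\<^sub>R G s + (D * q) *\<^sub>R z s) + (q *\<^sub>R B (G s) + c *\<^sub>R B (z s)))
        + (- l * e) *\<^sub>R (c *\<^sub>R z s + q *\<^sub>R B (z s))"
      unfolding 2 by (subst 1[symmetric]) (simp only: scaleR_add_right add_ac)
    with d show ?thesis by simp
  qed
  have "Y t = y" by (simp add: Y_def z_def CS)
  with Yd show ?thesis by blast
qed

lemma gronwall_integral:
  fixes u :: "real \<Rightarrow> real"
  assumes u: "continuous_on {t..b} u" and k: "0 \<le> k"
    and le: "\<And>s. s \<in> {t..b} \<Longrightarrow> u s \<le> c + k * integral {t..s} u"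
    and tb: "t \<le> b"
  shows "u b \<le> c * exp (k * (b - t))"
proof (cases "t = b")
  case True
  then show ?thesis using le[of t] by simp
next
  case False
  with tb have "t < b" by simp
  define U where "U s = c + k * integral {t..s} u" for s
  define p where "p s = U s * exp (- k * (s - t))" for s
  have Ud: "(U has_real_derivative k * u s) (at s within {t..b})" if "s \<in> {t..b}" for s
  proof -
    have "((\<lambda>s. integral {t..s} u) has_real_derivative u s) (at s within {t..b})"
      using integral_has_vector_derivative[OF u that]
      by (simp add: has_real_derivative_iff_has_vector_derivative)
    from DERIV_add[OF DERIV_const DERIV_cmult[OF this, of k], of c]
    show ?thesis unfolding U_def by simp
  qed
  have pd: "(p has_real_derivative k * (u s - U s) * exp (- k * (s - t))) (at s within {t..b})"
    if "s \<in> {t..b}" for s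
    unfolding p_def
    by (rule derivative_eq_intros Ud[OF that] refl)+ (simp add: algebra_simps)
  obtain s where s: "s \<in> {t<..<b}" "p b - p t = k * (u s - U s) * exp (- k * (s - t)) * (b - t)"
    using mvt_simple[OF \<open>t < b\<close>, of p "\<lambda>s. (*) (k * (u s - U s) * exp (- k * (s - t)))"] pd
    by (auto simp: has_field_derivative_def)
  have "k * (u s - U s) \<le> 0"
    using le[of s] s(1) k by (simp add: U_def mult_nonneg_nonpos)
  then have "p b - p t \<le> 0"
    using s \<open>t < b\<close> by (simp add: mult_nonpos_nonneg)
  then have "U b * exp (- k * (b - t)) \<le> c" by (simp add: p_def U_def)
  from mult_right_mono[OF this, of "exp (k * (b - t))"]
  have "U b \<le> c * exp (k * (b - t))"
    by (simp add: mult.assoc mult_exp_exp)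
  then show ?thesis using le[of b] tb by (simp add: U_def)
qed

text \<open>Solutions are indefinite integrals.\<close>

lemma continuous_on_solution:
  assumes "solves M t y \<omega> X"
  shows "continuous_on {t..b} X"
proof (cases "t \<le> b")
  case True
  let ?f = "\<lambda>r. dyn M (X r) (\<omega> r)"
  have int: "(?f has_integral (X s - y)) {t..s}" if "t \<le> s" for s
    using assms that by (simp add: solves_def)
  have "continuous_on {t..b} (\<lambda>s. y + integral {t..s} ?f)"
    using int[OF True] by (intro continuous_intros indefinite_integral_continuous_1) auto
  then show ?thesis
    by (rule continuous_on_eq) (simp add: integral_unique[OF int])
qed auto

lemma solution_initial: "solves M t y \<omega> X \<Longrightarrow> X t = y"
  using has_integral_unique[OF _ has_integral_refl(2), of "\<lambda>r. dyn M (X r) (\<omega> r)" "X t - y" t]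
  by (auto simp: solves_def)

text \<open>The demand cancels in the difference of two solutions for the same control, so the difference
  obeys the homogeneous linear equation. The case \<open>x = y\<close> is uniqueness.\<close>

lemma solution_difference_bound:
  assumes X: "solves M t x \<omega> X" and Y: "solves M t y \<omega> Y" and "t \<le> s"
  shows "norm (X s - Y s) \<le> norm (x - y) * exp (speed_slope M * (s - t))"
proof (rule gronwall_integral[OF _ speed_slope_nonneg _ \<open>t \<le> s\<close>])
  have cont: "continuous_on {t..b} (\<lambda>r. X r - Y r)" for b
    by (intro continuous_intros continuous_on_solution[OF X] continuous_on_solution[OF Y])
  then show "continuous_on {t..s} (\<lambda>r. norm (X r - Y r))"
    by (rule continuous_on_norm)
  fix r assume "r \<in> {t..s}"
  then have r: "t \<le> r" by simp
  have "((\<lambda>r. lin_part M (X r - Y r)) has_integral ((X r - x) - (Y r - y))) {t..r}"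
    using has_integral_diff[OF X[unfolded solves_def, rule_format, OF r]
        Y[unfolded solves_def, rule_format, OF r]] by (simp add: dyn_diff)
  then have i: "(X r - Y r) - (x - y) = integral {t..r} (\<lambda>r. lin_part M (X r - Y r))"
    and j: "(\<lambda>r. lin_part M (X r - Y r)) integrable_on {t..r}"
    by (auto simp: integral_unique algebra_simps)
  have "norm ((X r - Y r) - (x - y)) \<le> integral {t..r} (\<lambda>r. speed_slope M * norm (X r - Y r))"
    unfolding i
    by (intro integral_norm_bound_integral j integrable_continuous_real continuous_intros cont norm_lin_part)
  then show "norm (X r - Y r) \<le> norm (x - y) + speed_slope M * integral {t..r} (\<lambda>r. norm (X r - Y r))"
    using norm_triangle_sub[of "X r - Y r" "x - y"] by simp
qed

context control_problem
begin

lemma demand_integrable: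
  assumes w: "\<omega> \<in> control_funs M" and t: "0 \<le> t"
  shows "(\<lambda>r. demand M (\<omega> r)) integrable_on {t..s}"
proof -
  have m: "\<omega> \<in> borel_measurable (lebesgue_on {0..})" and c: "\<And>s. 0 \<le> s \<Longrightarrow> \<omega> s \<in> controls M"
    using w by (auto simp: control_funs_def)
  have "(\<lambda>r. demand M (\<omega> r)) \<in> borel_measurable (lebesgue_on {0..})"
    unfolding demand_def
    using borel_measurable_continuous_on[of fst, OF continuous_on_fst[OF continuous_on_id] m]
      borel_measurable_continuous_on[of snd, OF continuous_on_snd[OF continuous_on_id] m]
    by measurable
  then have "(\<lambda>r. demand M (\<omega> r)) \<in> borel_measurable (lebesgue_on {t..s})"
    by (rule measurable_restrict_mono) (use t in auto)
  then show ?thesis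
  proof (rule measurable_bounded_by_integrable_imp_integrable)
    show "(\<lambda>_. demand M (p_lo M, U_max M)) integrable_on {t..s}" by (rule integrable_const_ivl)
    show "norm (demand M (\<omega> r)) \<le> demand M (p_lo M, U_max M)" if "r \<in> {t..s}" for r
      using that t demand_bound[OF c[of r]] demand_nonneg[OF c[of r]] by simp
  qed auto
qed

text \<open>With a merely measurable control the equation need not have a classical solution. The integral \<open>E\<close> of the
  demand is continuous, however, and \<open>X\<close> solves the equation exactly if \<open>Y = X - E e\<close>, where \<open>e\<close> is the
  input direction, solves a linear equation with the continuous forcing \<open>A (E e)\<close>, where \<open>A\<close> is the
  linear part.\<close>

lemma solution_exists:
  assumes w: "\<omega> \<in> control_funs M" and t: "0 \<le> t"
  shows "\<exists>X. solves M t y \<omega> X"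
proof -
  define E where "E s = integral {t..s} (\<lambda>r. demand M (\<omega> r))" for s
  have E: "((\<lambda>r. demand M (\<omega> r)) has_integral E s) {t..s}" for s
    unfolding E_def using demand_integrable[OF w t] by (rule integrable_integral)
  have "continuous_on {t..b} E" for b
    unfolding E_def by (intro indefinite_integral_continuous_1 demand_integrable[OF w t])
  then have "continuous_on {t..b} (\<lambda>s. lin_part M (E s *\<^sub>R input_dir M))" for b
    by (intro bounded_linear.continuous_on[OF bounded_linear_lin_part] continuous_intros)
  then obtain Y where Y: "Y t = y" "\<And>b s. s \<in> {t..b} \<Longrightarrow>
      (Y has_vector_derivative lin_part M (Y s) + lin_part M (E s *\<^sub>R input_dir M)) (at s within {t..b})"
    using forced_linear_ode[of t "\<lambda>s. lin_part M (E s *\<^sub>R input_dir M)" y M] by blast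
  define X where "X s = Y s + E s *\<^sub>R input_dir M" for s
  have "((\<lambda>r. dyn M (X r) (\<omega> r)) has_integral (X s - y)) {t..s}" if "t \<le> s" for s
  proof -
    have "((\<lambda>r. lin_part M (X r)) has_integral (Y s - Y t)) {t..s}"
      by (rule fundamental_theorem_of_calculus[OF that]) (use Y(2) in \<open>auto simp: X_def lin_part_add\<close>)
    from has_integral_add[OF this has_integral_scaleR_left[OF E[of s], of "input_dir M"]]
    show ?thesis by (simp add: dyn_affine X_def Y(1) algebra_simps)
  qed
  then show ?thesis unfolding solves_def by blast
qed

lemma traj_solves: "\<omega> \<in> control_funs M \<Longrightarrow> 0 \<le> t \<Longrightarrow> solves M t y \<omega> (traj M t y \<omega>)"
  unfolding traj_def by (rule someI_ex[where P="solves M t y \<omega>", OF solution_exists])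

lemma traj_initial: "\<omega> \<in> control_funs M \<Longrightarrow> 0 \<le> t \<Longrightarrow> traj M t y \<omega> t = y"
  by (rule solution_initial[OF traj_solves])

lemma traj_unique:
  assumes "\<omega> \<in> control_funs M" "0 \<le> t" "solves M t y \<omega> X" "t \<le> s"
  shows "traj M t y \<omega> s = X s"
  using solution_difference_bound[OF traj_solves[OF assms(1,2), of y] assms(3,4)] by simp

lemma continuous_on_traj:
  "\<omega> \<in> control_funs M \<Longrightarrow> 0 \<le> t \<Longrightarrow> continuous_on {t..b} (traj M t y \<omega>)"
  by (rule continuous_on_solution[OF traj_solves])

lemma solves_shift:
  assumes "solves M t y \<omega> X" "t \<le> s"
  shows "solves M s (X s) \<omega> X"
  unfolding solves_def
proof (intro allI impI)
  fix r assume r: "s \<le> r"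
  let ?f = "\<lambda>r. dyn M (X r) (\<omega> r)"
  have a: "(?f has_integral (X s - y)) {t..s}" and b: "(?f has_integral (X r - y)) {t..r}"
    using assms r by (auto simp: solves_def)
  have i: "?f integrable_on {s..r}"
    using integrable_subinterval_real[OF has_integral_integrable[OF b]] assms(2) by auto
  have "integral {t..s} ?f + integral {s..r} ?f = integral {t..r} ?f"
    by (rule Henstock_Kurzweil_Integration.integral_combine[OF assms(2) r has_integral_integrable[OF b]])
  then have "integral {s..r} ?f = X r - X s"
    using integral_unique[OF a] integral_unique[OF b] by (simp add: algebra_simps)
  with i show "(?f has_integral (X r - X s)) {s..r}"
    by (metis integrable_integral)
qed

lemma traj_flow:
  assumes "\<omega> \<in> control_funs M" "0 \<le> t" "t \<le> s" "s \<le> r"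
  shows "traj M s (traj M t y \<omega> s) \<omega> r = traj M t y \<omega> r"
  by (rule traj_unique[OF assms(1) _ solves_shift[OF traj_solves[OF assms(1,2)]] assms(4)])
     (use assms in auto)

definition switch :: "real \<Rightarrow> (real \<Rightarrow> 'c) \<Rightarrow> (real \<Rightarrow> 'c) \<Rightarrow> real \<Rightarrow> 'c" where
  "switch s u w r = (if r \<le> s then u r else w r)"

lemma switch_control:
  assumes "u \<in> control_funs M" "w \<in> control_funs M"
  shows "switch s u w \<in> control_funs M"
proof -
  have "(\<lambda>r. if r \<le> s then u r else w r) \<in> borel_measurable (lebesgue_on {0..})"
  proof (rule measurable_If)
    have "{0..} \<inter> {..s} \<in> sets (lebesgue_on {0..})"
      by (auto simp: sets_restrict_space)
    moreover have "{x \<in> space (lebesgue_on {0..}). x \<le> s} = {0..} \<inter> {..s}"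
      by (auto simp: space_restrict_space)
    ultimately show "{x \<in> space (lebesgue_on {0..}). x \<le> s} \<in> sets (lebesgue_on {0..})" by simp
  qed (use assms in \<open>auto simp: control_funs_def\<close>)
  then show ?thesis
    using assms by (auto simp: control_funs_def switch_def[abs_def])
qed

text \<open>Gluing the two trajectories at time \<open>s\<close> gives a solution for the switched control: the integrands
  for the second control and for the switched one differ only at \<open>s\<close> itself.\<close>

lemma traj_switch:
  assumes u: "u \<in> control_funs M" and w: "w \<in> control_funs M" and t: "0 \<le> t" "t \<le> s"
  shows "t \<le> r \<Longrightarrow> r \<le> s \<Longrightarrow> traj M t y (switch s u w) r = traj M t y u r"
    and "s \<le> r \<Longrightarrow> traj M t y (switch s u w) r = traj M s (traj M t y u s) w r"
proof -
  let ?X = "traj M t y u" and ?Y = "traj M s (traj M t y u s) w"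
  have Ys: "?Y s = ?X s" using traj_initial[OF w] t by simp
  have X: "solves M t y u ?X" and Y: "solves M s (?X s) w ?Y"
    using traj_solves u w t by auto
  let ?Z = "switch s ?X ?Y" and ?f = "\<lambda>r. dyn M (switch s ?X ?Y r) (switch s u w r)"
  have Z: "solves M t y (switch s u w) ?Z"
    unfolding solves_def
  proof (intro allI impI)
    fix r assume r: "t \<le> r"
    have 1: "(?f has_integral (?X r - y)) {t..r}" if "t \<le> r" "r \<le> s" for r
      using X[unfolded solves_def, rule_format, OF that(1)]
      by (rule has_integral_eq[rotated]) (use that in \<open>auto simp: switch_def\<close>)
    show "(?f has_integral (?Z r - y)) {t..r}"
    proof (cases "r \<le> s")
      case True
      then show ?thesis using 1[OF r] by (simp add: switch_def)
    next
      case False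
      then have "s \<le> r" by simp
      have "(?f has_integral (?Y r - ?X s)) {s..r}"
        using Y[unfolded solves_def, rule_format, OF \<open>s \<le> r\<close>]
        by (rule has_integral_spike_finite[of "{s}", rotated 2]) (auto simp: switch_def)
      from has_integral_combine[OF t(2) \<open>s \<le> r\<close> 1[OF t(2) order_refl] this]
      show ?thesis using False by (simp add: switch_def)
    qed
  qed
  note eq = traj_unique[OF switch_control[OF u w] t(1) Z]
  show "t \<le> r \<Longrightarrow> r \<le> s \<Longrightarrow> traj M t y (switch s u w) r = ?X r"
    by (simp add: eq switch_def)
  show "s \<le> r \<Longrightarrow> traj M t y (switch s u w) r = ?Y r"
    using eq[of r] t Ys by (auto simp: switch_def)
qed

lemma traj_bounded:
  assumes w: "\<omega> \<in> control_funs M" and t: "0 \<le> t" "t \<le> s"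
  shows "norm (traj M t y \<omega> s) \<le> (norm y + speed_offset M * (s - t)) * exp (speed_slope M * (s - t))"
proof (rule gronwall_integral[OF _ speed_slope_nonneg _ t(2)])
  let ?X = "traj M t y \<omega>"
  have cont: "continuous_on {t..b} ?X" for b
    by (rule continuous_on_traj[OF w t(1)])
  then show "continuous_on {t..s} (\<lambda>r. norm (?X r))"
    by (rule continuous_on_norm)
  fix r assume r: "r \<in> {t..s}"
  have i: "((\<lambda>r. dyn M (?X r) (\<omega> r)) has_integral (?X r - y)) {t..r}"
    using traj_solves[OF w t(1), of y] r by (simp add: solves_def)
  have n: "(\<lambda>r. norm (?X r)) integrable_on {t..r}"
    by (intro integrable_continuous_real continuous_on_norm cont)
  have "norm (integral {t..r} (\<lambda>r. dyn M (?X r) (\<omega> r)))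
      \<le> integral {t..r} (\<lambda>r. speed_slope M * norm (?X r) + speed_offset M)"
    using w t
    by (intro integral_norm_bound_integral has_integral_integrable[OF i] norm_dyn
        integrable_continuous_real continuous_intros cont) (auto simp: control_funs_def)
  also have "\<dots> = speed_slope M * integral {t..r} (\<lambda>r. norm (?X r)) + speed_offset M * (r - t)"
    using r n by (subst Henstock_Kurzweil_Integration.integral_add) (auto intro: integrable_on_mult_right)
  also have "\<dots> \<le> speed_slope M * integral {t..r} (\<lambda>r. norm (?X r)) + speed_offset M * (s - t)"
    using r speed_offset_nonneg by (auto intro: mult_left_mono)
  finally show "norm (?X r) \<le> norm y + speed_offset M * (s - t) + speed_slope M * integral {t..r} (\<lambda>r. norm (?X r))"
    using norm_triangle_sub[of "?X r" y] by (simp add: integral_unique[OF i])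
qed

text \<open>The bound depends on the initial state but neither on the control nor on the initial time. This
  uniformity is what the short-time arguments below rest on.\<close>

lemma speed_bound:
  "\<exists>C\<ge>0. \<forall>\<omega>\<in>control_funs M. \<forall>t s. 0 \<le> t \<longrightarrow> t \<le> s \<longrightarrow> s \<le> horizon M \<longrightarrow>
    norm (dyn M (traj M t y \<omega> s) (\<omega> s)) \<le> C \<and> norm (traj M t y \<omega> s - y) \<le> C * (s - t)"
proof -
  let ?T = "horizon M"
  define R where "R = (norm y + speed_offset M * ?T) * exp (speed_slope M * ?T)"
  define C where "C = speed_slope M * R + speed_offset M"
  have R: "0 \<le> R" using speed_offset_nonneg horizon_pos by (auto simp: R_def)
  have C: "0 \<le> C" using R speed_offset_nonneg speed_slope_nonneg by (auto simp: C_def)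
  have d: "norm (dyn M (traj M t y \<omega> s) (\<omega> s)) \<le> C"
    if "\<omega> \<in> control_funs M" "0 \<le> t" "t \<le> s" "s \<le> ?T" for t s \<omega>
  proof -
    have "norm (traj M t y \<omega> s) \<le> (norm y + speed_offset M * (s - t)) * exp (speed_slope M * (s - t))"
      by (rule traj_bounded[OF that(1-3)])
    also have "\<dots> \<le> R"
      unfolding R_def using that speed_offset_nonneg speed_slope_nonneg horizon_pos
      by (intro mult_mono add_left_mono mult_left_mono iffD2[OF exp_le_cancel_iff] add_nonneg_nonneg mult_nonneg_nonneg) auto
    finally have "speed_slope M * norm (traj M t y \<omega> s) \<le> speed_slope M * R"
      using speed_slope_nonneg by (rule mult_left_mono)
    then show ?thesis
      using norm_dyn[of "\<omega> s" "traj M t y \<omega> s"] that by (auto simp: C_def control_funs_def)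
  qed
  have "norm (traj M t y \<omega> s - y) \<le> C * (s - t)"
    if "\<omega> \<in> control_funs M" "0 \<le> t" "t \<le> s" "s \<le> ?T" for t s \<omega>
  proof -
    have "((\<lambda>r. dyn M (traj M t y \<omega> r) (\<omega> r)) has_integral (traj M t y \<omega> s - y)) {t..s}"
      using traj_solves[OF that(1,2), of y] that by (simp add: solves_def)
    from has_integral_bound_real[OF C _ this, of "{}"] show ?thesis
      using d that by auto
  qed
  with C d show ?thesis by blast
qed

lemma traj_lipschitz:
  assumes "\<omega> \<in> control_funs M" "0 \<le> t" "t \<le> s" "s \<le> horizon M"
  shows "norm (traj M t x \<omega> s - traj M t y \<omega> s) \<le> norm (x - y) * exp (speed_slope M * horizon M)"
proof -
  have "norm (traj M t x \<omega> s - traj M t y \<omega> s) \<le> norm (x - y) * exp (speed_slope M * (s - t))"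
    by (rule solution_difference_bound[OF traj_solves[OF assms(1,2)] traj_solves[OF assms(1,2)] assms(3)])
  also have "\<dots> \<le> norm (x - y) * exp (speed_slope M * horizon M)"
    using assms speed_slope_nonneg by (intro mult_left_mono) (auto intro: mult_left_mono)
  finally show ?thesis .
qed

end

section \<open>The value function and dynamic programming\<close>

text \<open>The running cost of the value function is a supremum over an open time interval; by continuity it
  also dominates the values at both end points.\<close>

lemma le_SUP_open_interval:
  fixes h :: "real \<Rightarrow> real"
  assumes h: "continuous_on {a..b} h" and ab: "a < b" and s: "s \<in> {a..b}"
  shows "h s \<le> (SUP r\<in>{a<..<b}. h r)"
proof -
  have "bdd_above (h ` {a..b})"
    by (intro bounded_imp_bdd_above compact_imp_bounded compact_continuous_image h compact_Icc)
  then have bdd: "bdd_above (h ` {a<..<b})"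
    by (rule bdd_above_mono) auto
  have "closure {a<..<b} = {a..b}" using ab by simp
  moreover have "h r \<le> (SUP r\<in>{a<..<b}. h r)" if "r \<in> {a<..<b}" for r
    by (rule cSUP_upper[OF that bdd])
  ultimately show ?thesis
    using continuous_le_on_closure[of "{a<..<b}" h s] h s by simp
qed

context control_problem
begin

lemma g_lipschitz: "\<bar>g_fun M x - g_fun M y\<bar> \<le> Lip * norm (x - y)"
  using lipschitz_onD[OF lipschitz_g, of x y] by (simp add: dist_norm)

lemma v0_lipschitz: "\<bar>v0_fun M x - v0_fun M y\<bar> \<le> Lip * norm (x - y)"
  using lipschitz_onD[OF lipschitz_v0, of x y] by (simp add: dist_norm)

lemma Lip_nonneg: "0 \<le> Lip"
  by (rule lipschitz_on_nonneg[OF lipschitz_g])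

lemma continuous_on_g: "continuous_on A (g_fun M)"
  by (rule continuous_on_subset[OF lipschitz_on_continuous_on[OF lipschitz_g]]) auto

lemma constant_control: "\<omega>0 \<in> controls M \<Longrightarrow> (\<lambda>_. \<omega>0) \<in> control_funs M"
  by (simp add: control_funs_def)

lemma control_funs_nonempty: "control_funs M \<noteq> {}"
  using constant_control[OF full_effort_mem] by auto

lemma running_cost_le_SUP:
  assumes "\<omega> \<in> control_funs M" "0 \<le> t" "t < horizon M" "s \<in> {t..horizon M}"
  shows "g_fun M (traj M t y \<omega> s) \<le> (SUP r\<in>{t<..<horizon M}. g_fun M (traj M t y \<omega> r))"
  using assms
  by (intro le_SUP_open_interval[of t "horizon M" "\<lambda>s. g_fun M (traj M t y \<omega> s)"]
      continuous_on_compose2[OF continuous_on_g continuous_on_traj]) auto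

text \<open>Together with the next lemma this describes the value by inequalities: the value is the greatest lower
  bound of all \<open>c\<close> for which some control keeps both the terminal and the running cost at most \<open>c\<close>. Both
  statements include the terminal time, where the trajectory is a single point.\<close>

lemma value_le:
  assumes w: "\<omega> \<in> control_funs M" and t: "0 \<le> t" "t \<le> horizon M"
    and terminal: "v0_fun M (traj M t y \<omega> (horizon M)) \<le> c"
    and running: "\<And>s. t \<le> s \<Longrightarrow> s \<le> horizon M \<Longrightarrow> g_fun M (traj M t y \<omega> s) \<le> c"
  shows "value_fun M t y \<le> c"
proof (cases "t < horizon M")
  case True
  let ?J = "\<lambda>\<omega>. max (v0_fun M (traj M t y \<omega> (horizon M)))
                 (SUP s\<in>{t<..<horizon M}. g_fun M (traj M t y \<omega> s))"
  have "bdd_below (?J ` control_funs M)"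
  proof (rule bdd_belowI2)
    show "g_fun M y \<le> ?J \<omega>" if "\<omega> \<in> control_funs M" for \<omega>
      using running_cost_le_SUP[OF that t(1) True, of t y] traj_initial[OF that t(1), of y] True
      by simp
  qed
  then have "(INF \<omega>\<in>control_funs M. ?J \<omega>) \<le> ?J \<omega>"
    using w by (rule cINF_lower)
  also have "(SUP s\<in>{t<..<horizon M}. g_fun M (traj M t y \<omega> s)) \<le> c"
    using True running by (intro cSUP_least) auto
  then have "?J \<omega> \<le> c"
    using terminal by simp
  finally show ?thesis using True by (simp add: value_fun_def)
next
  case False
  with t have T: "t = horizon M" by simp
  then show ?thesis
    using terminal running[of t] traj_initial[OF w t(1), of y] by (simp add: value_fun_def)
qed

lemma value_less_obtain:
  assumes less: "value_fun M t y < c" and t: "0 \<le> t" "t \<le> horizon M"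
  obtains \<omega> where "\<omega> \<in> control_funs M"
    and "v0_fun M (traj M t y \<omega> (horizon M)) \<le> c"
    and "\<And>s. t \<le> s \<Longrightarrow> s \<le> horizon M \<Longrightarrow> g_fun M (traj M t y \<omega> s) \<le> c"
proof (cases "t < horizon M")
  case True
  let ?J = "\<lambda>\<omega>. max (v0_fun M (traj M t y \<omega> (horizon M)))
                 (SUP s\<in>{t<..<horizon M}. g_fun M (traj M t y \<omega> s))"
  have "Inf (?J ` control_funs M) < c" using less True by (simp add: value_fun_def)
  then obtain \<omega> where w: "\<omega> \<in> control_funs M" and J: "?J \<omega> < c"
    using cInf_lessD[of "?J ` control_funs M" c] control_funs_nonempty by auto
  show thesis
  proof (rule that[OF w])
    show "v0_fun M (traj M t y \<omega> (horizon M)) \<le> c" using J by simp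
    show "g_fun M (traj M t y \<omega> s) \<le> c" if "t \<le> s" "s \<le> horizon M" for s
      using running_cost_le_SUP[OF w t(1) True, of s y] that J by simp
  qed
next
  case False
  with t have T: "t = horizon M" by simp
  obtain \<omega> where w: "\<omega> \<in> control_funs M" using control_funs_nonempty by auto
  have "max (v0_fun M y) (g_fun M y) < c" using less T by (simp add: value_fun_def)
  then show thesis
    using that[OF w] traj_initial[OF w t(1), of y] T by (metis antisym less_imp_le max_less_iff_conj)
qed

lemma obstacle_le_value:
  assumes t: "0 \<le> t" "t \<le> horizon M"
  shows "g_fun M y \<le> value_fun M t y"
proof (rule dense_ge)
  fix c assume "value_fun M t y < c"
  then obtain \<omega> where "\<omega> \<in> control_funs M"
    "\<And>s. t \<le> s \<Longrightarrow> s \<le> horizon M \<Longrightarrow> g_fun M (traj M t y \<omega> s) \<le> c"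
    using value_less_obtain[OF _ t] by blast
  then show "g_fun M y \<le> c" using t traj_initial[of \<omega> t y] by force
qed

text \<open>The first half of the dynamic programming principle: after following \<open>\<omega>\<close> until \<open>s\<close> one may switch to
  a nearly optimal control for the state reached.\<close>

lemma value_le_along:
  assumes w: "\<omega> \<in> control_funs M" and t: "0 \<le> t" "t \<le> s" "s \<le> horizon M"
    and later: "value_fun M s (traj M t y \<omega> s) \<le> c"
    and running: "\<And>r. t \<le> r \<Longrightarrow> r \<le> s \<Longrightarrow> g_fun M (traj M t y \<omega> r) \<le> c"
  shows "value_fun M t y \<le> c"
proof (rule dense_ge)
  fix c' assume c': "c < c'"
  let ?x = "traj M t y \<omega> s"
  have s0: "0 \<le> s" using t by simp
  obtain u where u: "u \<in> control_funs M"
      "v0_fun M (traj M s ?x u (horizon M)) \<le> c'"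
      "\<And>r. s \<le> r \<Longrightarrow> r \<le> horizon M \<Longrightarrow> g_fun M (traj M s ?x u r) \<le> c'"
    using value_less_obtain[OF order.strict_trans1[OF later c'] s0 t(3)] by blast
  note sw = traj_switch[OF w u(1) t(1,2)]
  show "value_fun M t y \<le> c'"
  proof (rule value_le[OF switch_control[OF w u(1)] t(1)])
    show "t \<le> horizon M" using t by simp
    show "v0_fun M (traj M t y (switch s \<omega> u) (horizon M)) \<le> c'"
      using u(2) sw(2)[OF t(3)] by simp
    show "g_fun M (traj M t y (switch s \<omega> u) r) \<le> c'" if "t \<le> r" "r \<le> horizon M" for r
    proof (cases "r \<le> s")
      case True
      then show ?thesis using sw(1)[OF that(1) True] running[OF that(1) True] c' by simp
    next
      case False
      then show ?thesis using sw(2)[of r] u(3)[of r] that by simp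
    qed
  qed
qed

text \<open>The second half of the dynamic programming principle: a nearly optimal control for \<open>(t, y)\<close> remains
  nearly optimal for the states that it reaches later.\<close>

lemma value_less_along:
  assumes less: "value_fun M t y < c" and t: "0 \<le> t" "t \<le> s" "s \<le> horizon M"
  obtains \<omega> where "\<omega> \<in> control_funs M" and "value_fun M s (traj M t y \<omega> s) \<le> c"
proof -
  have "t \<le> horizon M" using t by simp
  then obtain \<omega> where w: "\<omega> \<in> control_funs M"
    "v0_fun M (traj M t y \<omega> (horizon M)) \<le> c"
    "\<And>s. t \<le> s \<Longrightarrow> s \<le> horizon M \<Longrightarrow> g_fun M (traj M t y \<omega> s) \<le> c"
    using value_less_obtain[OF less t(1)] by blast
  note fl = traj_flow[OF w(1) t(1,2), of _ y]
  have "value_fun M s (traj M t y \<omega> s) \<le> c"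
    by (rule value_le[OF w(1)]) (use t w(2,3) fl in auto)
  with w(1) that show thesis by blast
qed

definition value_slope :: real where
  "value_slope = Lip * exp (speed_slope M * horizon M)"

text \<open>A control that is good for one initial state is used for the other one; the two trajectories stay
  close.\<close>

lemma value_lipschitz_state:
  assumes t: "0 \<le> t" "t \<le> horizon M"
  shows "\<bar>value_fun M t x - value_fun M t y\<bar> \<le> value_slope * norm (x - y)"
proof -
  have "value_fun M t x \<le> value_fun M t y + value_slope * norm (x - y)" for x y
  proof (rule dense_ge)
    fix c' assume c': "value_fun M t y + value_slope * norm (x - y) < c'"
    define c where "c = c' - value_slope * norm (x - y)"
    have "value_fun M t y < c" using c' by (simp add: c_def)
    then obtain \<omega> where w: "\<omega> \<in> control_funs M"
      "v0_fun M (traj M t y \<omega> (horizon M)) \<le> c"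
      "\<And>s. t \<le> s \<Longrightarrow> s \<le> horizon M \<Longrightarrow> g_fun M (traj M t y \<omega> s) \<le> c"
      using value_less_obtain[OF _ t] by blast
    have close: "Lip * norm (traj M t x \<omega> s - traj M t y \<omega> s) \<le> value_slope * norm (x - y)"
      if "t \<le> s" "s \<le> horizon M" for s
      using mult_left_mono[OF traj_lipschitz[OF w(1) t(1) that, of x y] Lip_nonneg]
      by (simp add: value_slope_def mult_ac)
    show "value_fun M t x \<le> c'"
    proof (rule value_le[OF w(1) t])
      show "v0_fun M (traj M t x \<omega> (horizon M)) \<le> c'"
        using v0_lipschitz[of "traj M t x \<omega> (horizon M)" "traj M t y \<omega> (horizon M)"]
          w(2) close[OF t(2) order_refl] by (simp add: c_def)
      show "g_fun M (traj M t x \<omega> s) \<le> c'" if "t \<le> s" "s \<le> horizon M" for s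
        using g_lipschitz[of "traj M t x \<omega> s" "traj M t y \<omega> s"]
          w(3)[OF that] close[OF that] by (simp add: c_def)
    qed
  qed
  from this[of x y] this[of y x] show ?thesis by (simp add: norm_minus_commute abs_le_iff)
qed

text \<open>Dynamic programming turns a difference in time into one in state: trajectories move by at most
  \<open>C (s - t)\<close> between \<open>t\<close> and \<open>s\<close>, and the value is Lipschitz in the state. The running cost in between
  exceeds \<open>g_fun M y\<close>, a lower bound of the value, by at most a multiple of \<open>s - t\<close>.\<close>

lemma value_lipschitz_time:
  obtains C where "0 \<le> C" and "\<And>t s. 0 \<le> t \<Longrightarrow> t \<le> horizon M \<Longrightarrow> 0 \<le> s \<Longrightarrow> s \<le> horizon M \<Longrightarrow>
    \<bar>value_fun M t y - value_fun M s y\<bar> \<le> C * \<bar>t - s\<bar>"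
proof -
  obtain C where C: "0 \<le> C"
    and speed: "\<And>t s \<omega>. \<omega> \<in> control_funs M \<Longrightarrow> 0 \<le> t \<Longrightarrow> t \<le> s \<Longrightarrow> s \<le> horizon M \<Longrightarrow>
        norm (traj M t y \<omega> s - y) \<le> C * (s - t)"
    using speed_bound[of y] by metis
  define L where "L = max Lip value_slope"
  have L: "0 \<le> L" using Lip_nonneg by (simp add: L_def)
  have near: "Lip * norm (traj M t y \<omega> s - y) \<le> L * C * (s - t)"
    "value_slope * norm (traj M t y \<omega> s - y) \<le> L * C * (s - t)"
    if "\<omega> \<in> control_funs M" "0 \<le> t" "t \<le> s" "s \<le> horizon M" for t s \<omega>
  proof -
    have "Lip * norm (traj M t y \<omega> s - y) \<le> L * norm (traj M t y \<omega> s - y)"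
      "value_slope * norm (traj M t y \<omega> s - y) \<le> L * norm (traj M t y \<omega> s - y)"
      by (auto simp: L_def intro: mult_right_mono)
    moreover have "L * norm (traj M t y \<omega> s - y) \<le> L * C * (s - t)"
      using mult_left_mono[OF speed[OF that] L] by (simp add: mult_ac)
    ultimately show "Lip * norm (traj M t y \<omega> s - y) \<le> L * C * (s - t)"
      "value_slope * norm (traj M t y \<omega> s - y) \<le> L * C * (s - t)" by linarith+
  qed
  have le: "\<bar>value_fun M t y - value_fun M s y\<bar> \<le> L * C * (s - t)"
    if t: "0 \<le> t" "t \<le> s" "s \<le> horizon M" for t s
  proof -
    have s: "0 \<le> s" using t by simp
    have "value_fun M t y \<le> value_fun M s y + L * C * (s - t)"
    proof -
      obtain \<omega> where w: "\<omega> \<in> control_funs M" using control_funs_nonempty by auto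
      show ?thesis
      proof (rule value_le_along[OF w t])
        show "value_fun M s (traj M t y \<omega> s) \<le> value_fun M s y + L * C * (s - t)"
          using value_lipschitz_state[OF s t(3), of "traj M t y \<omega> s" y] near(2)[OF w t] by linarith
        fix r assume r: "t \<le> r" "r \<le> s"
        have "L * C * (r - t) \<le> L * C * (s - t)"
          using r L C by (intro mult_left_mono) auto
        then show "g_fun M (traj M t y \<omega> r) \<le> value_fun M s y + L * C * (s - t)"
          using g_lipschitz[of "traj M t y \<omega> r" y] near(1)[OF w t(1), of r] r t
            obstacle_le_value[OF s t(3), of y] by linarith
      qed
    qed
    moreover have "value_fun M s y - L * C * (s - t) \<le> value_fun M t y"
    proof (rule dense_ge)
      fix c assume "value_fun M t y < c"
      then obtain \<omega> where w: "\<omega> \<in> control_funs M" "value_fun M s (traj M t y \<omega> s) \<le> c"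
        using value_less_along[OF _ t] by blast
      then show "value_fun M s y - L * C * (s - t) \<le> c"
        using value_lipschitz_state[OF s t(3), of "traj M t y \<omega> s" y] near(2)[OF w(1) t] by linarith
    qed
    ultimately show ?thesis by linarith
  qed
  show thesis
  proof (rule that[of "L * C"])
    show "0 \<le> L * C" using L C by simp
    show "\<bar>value_fun M t y - value_fun M s y\<bar> \<le> L * C * \<bar>t - s\<bar>"
      if "0 \<le> t" "t \<le> horizon M" "0 \<le> s" "s \<le> horizon M" for t s
      using le[of t s] le[of s t] that by (cases "t \<le> s") (auto simp: abs_minus_commute)
  qed
qed

lemma continuous_on_value:
  "continuous_on ({0..horizon M} \<times> D) (\<lambda>z. value_fun M (fst z) (snd z))"
  unfolding continuous_on_def
proof
  fix z0 :: "real \<times> state" assume z0: "z0 \<in> {0..horizon M} \<times> D"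
  let ?A = "{0..horizon M} \<times> D"
  obtain C where C: "\<And>t s. 0 \<le> t \<Longrightarrow> t \<le> horizon M \<Longrightarrow> 0 \<le> s \<Longrightarrow> s \<le> horizon M \<Longrightarrow>
    \<bar>value_fun M t (snd z0) - value_fun M s (snd z0)\<bar> \<le> C * \<bar>t - s\<bar>"
    using value_lipschitz_time[of "snd z0"] by metis
  let ?b = "\<lambda>z. value_slope * norm (snd z - snd z0) + C * \<bar>fst z - fst z0\<bar>"
  have "continuous (at z0 within ?A) ?b" by (intro continuous_intros)
  then have lim: "(?b \<longlongrightarrow> 0) (at z0 within ?A)" by (simp add: continuous_within)
  have "\<forall>\<^sub>F z in at z0 within ?A.
      norm (value_fun M (fst z) (snd z) - value_fun M (fst z0) (snd z0)) \<le> ?b z"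
    unfolding eventually_at_filter
  proof (intro always_eventually allI impI)
    fix z :: "real \<times> state" assume "z \<in> ?A"
    then show "norm (value_fun M (fst z) (snd z) - value_fun M (fst z0) (snd z0)) \<le> ?b z"
      using value_lipschitz_state[of "fst z" "snd z" "snd z0"] C[of "fst z" "fst z0"] z0 by auto
  qed
  from Lim_null_comparison[OF this lim]
  show "((\<lambda>z. value_fun M (fst z) (snd z)) \<longlongrightarrow> value_fun M (fst z0) (snd z0)) (at z0 within ?A)"
    by (rule LIM_zero_cancel)
qed

end

section \<open>The value function solves the equation in the viscosity sense\<close>

context control_problem
begin

lemma trajectories_stay_near:
  assumes t: "0 \<le> t" "t < horizon M" and e: "0 < e"
  shows "\<exists>h0>0. t + h0 \<le> horizon M \<and>
    (\<forall>h\<in>{0..h0}. \<forall>\<omega>\<in>control_funs M. dist (t + h, traj M t y \<omega> (t + h)) (t, y) < e)"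
proof -
  obtain C where C: "0 \<le> C"
    and speed: "\<And>t s \<omega>. \<omega> \<in> control_funs M \<Longrightarrow> 0 \<le> t \<Longrightarrow> t \<le> s \<Longrightarrow> s \<le> horizon M \<Longrightarrow>
        norm (traj M t y \<omega> s - y) \<le> C * (s - t)"
    using speed_bound[of y] by metis
  define h0 where "h0 = min (horizon M - t) (e / (2 * (1 + C)))"
  have "dist (t + h, traj M t y \<omega> (t + h)) (t, y) < e"
    if h: "h \<in> {0..h0}" and w: "\<omega> \<in> control_funs M" for h \<omega>
  proof -
    have "dist (t + h, traj M t y \<omega> (t + h)) (t, y) \<le> norm h + norm (traj M t y \<omega> (t + h) - y)"
      using norm_Pair_le[of h "traj M t y \<omega> (t + h) - y"] by (simp add: dist_norm)
    also have "\<dots> \<le> h * (1 + C)"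
      using speed[OF w t(1), of "t + h"] h by (simp add: h0_def algebra_simps)
    also have "\<dots> \<le> e / (2 * (1 + C)) * (1 + C)"
      using h C by (intro mult_right_mono) (auto simp: h0_def)
    also have "\<dots> = e / 2" using C by (auto simp: divide_simps algebra_simps)
    also have "\<dots> < e" using e by simp
    finally show ?thesis .
  qed
  moreover have "0 < h0" "t + h0 \<le> horizon M" using t e C by (auto simp: h0_def)
  ultimately show ?thesis by blast
qed

text \<open>Trajectories are differentiable only almost everywhere, so the chain rule along them is avoided:
  the mean value theorem on the segment from \<open>(t, y)\<close> to the end point of the
  trajectory yields a gradient at one fixed point \<open>z\<close>, and its inner product with the displacement is
  the integral of its inner products with the velocities. Near \<open>(t, y)\<close> the resulting rate of
  change of \<open>\<phi>\<close> differs from its value at \<open>(t, y)\<close> by at most \<open>k / 2\<close>.\<close>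

lemma test_function_increases:
  assumes C1: "C1_test G \<phi> \<phi>t \<phi>y" and G: "open G" "(t, y) \<in> G"
    and t: "0 \<le> t" "t < horizon M" and k: "0 < k"
    and W: "\<And>c. c \<in> W \<Longrightarrow> k \<le> \<phi>t (t, y) + dyn M y c \<bullet> \<phi>y (t, y)"
  shows "\<exists>h0>0. \<forall>h\<in>{0<..h0}. \<forall>\<omega>\<in>control_funs M. (\<forall>s\<ge>0. \<omega> s \<in> W) \<longrightarrow>
    \<phi> (t, y) + k / 2 * h \<le> \<phi> (t + h, traj M t y \<omega> (t + h))"
proof -
  let ?z0 = "(t, y)"
  obtain C where C: "0 \<le> C"
    and dynb: "\<And>t s \<omega>. \<omega> \<in> control_funs M \<Longrightarrow> 0 \<le> t \<Longrightarrow> t \<le> s \<Longrightarrow> s \<le> horizon M \<Longrightarrow>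
        norm (dyn M (traj M t y \<omega> s) (\<omega> s)) \<le> C"
    and speed: "\<And>t s \<omega>. \<omega> \<in> control_funs M \<Longrightarrow> 0 \<le> t \<Longrightarrow> t \<le> s \<Longrightarrow> s \<le> horizon M \<Longrightarrow>
        norm (traj M t y \<omega> s - y) \<le> C * (s - t)"
    using speed_bound[of y] by metis
  \<comment> \<open>The error \<open>k / 2\<close> is shared: \<open>e + C e = k / 4\<close> for the variation of the derivatives of \<open>\<phi>\<close>, and
      \<open>Q h \<le> k / 4\<close> for the variation of the velocity.\<close>
  define e where "e = k / (4 * (1 + C))"
  have "e * (1 + C) = k / 4" using C by (auto simp: e_def divide_simps algebra_simps)
  then have e: "0 < e" "e + C * e = k / 4"
    using C k by (simp add: e_def, simp add: algebra_simps)
  define Q where "Q = speed_slope M * C * norm (\<phi>y ?z0)"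
  have Q: "0 \<le> Q" using C speed_slope_nonneg by (simp add: Q_def)
  have "continuous (at ?z0) \<phi>t" "continuous (at ?z0) \<phi>y"
    using C1 G by (auto simp: C1_test_def continuous_on_eq_continuous_at)
  then have "\<forall>\<^sub>F z in nhds ?z0. dist (\<phi>t z) (\<phi>t ?z0) < e" "\<forall>\<^sub>F z in nhds ?z0. dist (\<phi>y z) (\<phi>y ?z0) < e"
    using e(1) by (auto simp: isCont_def tendsto_at_iff_tendsto_nhds dest: tendstoD)
  moreover have "\<forall>\<^sub>F z in nhds ?z0. z \<in> G" using G by (rule eventually_nhds_in_open)
  ultimately have "\<forall>\<^sub>F z in nhds ?z0. z \<in> G \<and> dist (\<phi>t z) (\<phi>t ?z0) < e \<and> dist (\<phi>y z) (\<phi>y ?z0) < e"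
    by eventually_elim simp
  then obtain d where d: "0 < d" "\<And>z. dist z ?z0 < d \<Longrightarrow>
      z \<in> G \<and> dist (\<phi>t z) (\<phi>t ?z0) < e \<and> dist (\<phi>y z) (\<phi>y ?z0) < e"
    unfolding eventually_nhds_metric by metis
  obtain h1 where h1: "0 < h1" "t + h1 \<le> horizon M"
    "\<And>h \<omega>. h \<in> {0..h1} \<Longrightarrow> \<omega> \<in> control_funs M \<Longrightarrow> dist (t + h, traj M t y \<omega> (t + h)) ?z0 < d"
    using trajectories_stay_near[OF t d(1), of y] by metis
  define h0 where "h0 = min h1 (k / (4 * (1 + Q)))"
  have h0: "0 < h0" using h1(1) k Q by (simp add: h0_def)
  have "\<phi> ?z0 + k / 2 * h \<le> \<phi> (t + h, traj M t y \<omega> (t + h))"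
    if h: "h \<in> {0<..h0}" and w: "\<omega> \<in> control_funs M" and ww: "\<And>s. 0 \<le> s \<Longrightarrow> \<omega> s \<in> W" for h \<omega>
  proof -
    let ?X = "traj M t y \<omega>"
    let ?z1 = "(t + h, ?X (t + h))"
    define \<Delta> where "\<Delta> = ?z1 - ?z0"
    have \<Delta>: "fst \<Delta> = h" "snd \<Delta> = ?X (t + h) - y" by (simp_all add: \<Delta>_def)
    have z1: "dist ?z1 ?z0 < d" using h1(3)[OF _ w, of h] h by (simp add: h0_def)
    have seg: "dist (?z0 + \<tau> *\<^sub>R \<Delta>) ?z0 < d" if "\<tau> \<in> {0..1}" for \<tau> :: real
    proof -
      have "dist (?z0 + \<tau> *\<^sub>R \<Delta>) ?z0 = norm (\<tau> *\<^sub>R \<Delta>)"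
        by (simp only: dist_norm add_diff_cancel_left')
      also have "\<dots> = \<tau> * dist ?z1 ?z0"
        using that by (simp only: dist_norm \<Delta>_def norm_scaleR) simp
      also have "\<dots> \<le> 1 * dist ?z1 ?z0"
        using that by (intro mult_right_mono) auto
      finally show ?thesis using z1 by simp
    qed
    have der: "((\<lambda>\<tau>. \<phi> (?z0 + \<tau> *\<^sub>R \<Delta>)) has_derivative
       (\<lambda>r. \<phi>t (?z0 + \<tau> *\<^sub>R \<Delta>) * fst (r *\<^sub>R \<Delta>) + \<phi>y (?z0 + \<tau> *\<^sub>R \<Delta>) \<bullet> snd (r *\<^sub>R \<Delta>)))
       (at \<tau> within {0..1})" if "\<tau> \<in> {0..1}" for \<tau> :: real
    proof -
      have "(\<phi> has_derivative (\<lambda>v. \<phi>t (?z0 + \<tau> *\<^sub>R \<Delta>) * fst v + \<phi>y (?z0 + \<tau> *\<^sub>R \<Delta>) \<bullet> snd v))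
          (at (?z0 + \<tau> *\<^sub>R \<Delta>))"
        using C1 d(2)[OF seg[OF that]] by (auto simp: C1_test_def)
      moreover have "((\<lambda>\<tau>. ?z0 + \<tau> *\<^sub>R \<Delta>) has_derivative (\<lambda>r. r *\<^sub>R \<Delta>)) (at \<tau> within {0..1})"
        by (auto intro!: derivative_eq_intros)
      ultimately show ?thesis
        using has_derivative_compose by blast
    qed
    obtain \<tau> where \<tau>: "\<tau> \<in> {0<..<1}"
      "\<phi> (?z0 + 1 *\<^sub>R \<Delta>) - \<phi> (?z0 + 0 *\<^sub>R \<Delta>) =
        \<phi>t (?z0 + \<tau> *\<^sub>R \<Delta>) * fst ((1 - 0) *\<^sub>R \<Delta>) + \<phi>y (?z0 + \<tau> *\<^sub>R \<Delta>) \<bullet> snd ((1 - 0) *\<^sub>R \<Delta>)"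
      using mvt_simple[OF zero_less_one der] by auto
    define z where "z = ?z0 + \<tau> *\<^sub>R \<Delta>"
    have zd: "dist z ?z0 < d" using seg[of \<tau>] \<tau>(1) by (simp add: z_def)
    have pt: "\<bar>\<phi>t z - \<phi>t ?z0\<bar> < e" and py: "norm (\<phi>y z - \<phi>y ?z0) < e"
      using d(2)[OF zd] by (auto simp: dist_norm)
    have inc: "\<phi> ?z1 - \<phi> ?z0 = \<phi>t z * h + \<phi>y z \<bullet> (?X (t + h) - y)"
      using \<tau>(2) by (simp add: z_def[symmetric] \<Delta>) (simp add: \<Delta>_def)
    have "((\<lambda>r. dyn M (?X r) (\<omega> r)) has_integral (?X (t + h) - y)) {t..t + h}"
      using traj_solves[OF w t(1), of y] h by (simp add: solves_def)
    from has_integral_linear[OF this bounded_linear_inner_right[of "\<phi>y z"]]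
    have i: "((\<lambda>r. \<phi>y z \<bullet> dyn M (?X r) (\<omega> r)) has_integral (\<phi>y z \<bullet> (?X (t + h) - y))) {t..t + h}"
      by (simp add: o_def)
    have "h * (k / 2 - \<phi>t z) \<le> \<phi>y z \<bullet> (?X (t + h) - y)"
    proof (rule has_integral_le[OF _ i])
      show "((\<lambda>_. k / 2 - \<phi>t z) has_integral h * (k / 2 - \<phi>t z)) {t..t + h}"
        using has_integral_const_real[of "k / 2 - \<phi>t z" t "t + h"] h by simp
      fix r assume r: "r \<in> {t..t + h}"
      then have rT: "t \<le> r" "r \<le> horizon M" using h h1(2) by (auto simp: h0_def)
      let ?f = "dyn M (?X r) (\<omega> r)" and ?e = "dyn M y (\<omega> r)"
      have "\<bar>?f \<bullet> (\<phi>y z - \<phi>y ?z0)\<bar> \<le> C * e"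
        using Cauchy_Schwarz_ineq2[of ?f "\<phi>y z - \<phi>y ?z0"] mult_mono[OF dynb[OF w t(1) rT] less_imp_le[OF py] C]
        by simp
      moreover have "\<bar>(?f - ?e) \<bullet> \<phi>y ?z0\<bar> \<le> k / 4"
      proof -
        have "\<bar>(?f - ?e) \<bullet> \<phi>y ?z0\<bar> \<le> norm (?f - ?e) * norm (\<phi>y ?z0)"
          by (rule Cauchy_Schwarz_ineq2)
        also have "\<dots> \<le> (speed_slope M * (C * h)) * norm (\<phi>y ?z0)"
        proof (rule mult_right_mono)
          have "norm (?X r - y) \<le> C * h"
            using speed[OF w t(1) rT] mult_left_mono[of "r - t" h, OF _ C] r by simp
          then show "norm (?f - ?e) \<le> speed_slope M * (C * h)"
            unfolding dyn_diff
            using norm_lin_part[of M "?X r - y"] mult_left_mono[OF _ speed_slope_nonneg[of M]]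
            by (meson order_trans)
        qed simp
        also have "\<dots> = Q * h" by (simp add: Q_def)
        also have "\<dots> \<le> (1 + Q) * (k / (4 * (1 + Q)))"
          using h Q k by (intro mult_mono) (auto simp: h0_def)
        also have "\<dots> = k / 4" using Q by (simp add: field_simps)
        finally show ?thesis .
      qed
      moreover have "\<phi>y z \<bullet> ?f = ?e \<bullet> \<phi>y ?z0 + ?f \<bullet> (\<phi>y z - \<phi>y ?z0) + (?f - ?e) \<bullet> \<phi>y ?z0"
        by (simp add: inner_diff_left inner_diff_right inner_commute)
      moreover have "k \<le> \<phi>t ?z0 + ?e \<bullet> \<phi>y ?z0"
        using W[OF ww[of r]] t(1) rT by simp
      ultimately show "k / 2 - \<phi>t z \<le> \<phi>y z \<bullet> ?f"
        using pt e(2) by linarith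
    qed
    then have "\<phi>t z * h + \<phi>y z \<bullet> (?X (t + h) - y) \<ge> k / 2 * h"
      by (simp add: algebra_simps)
    with inc show ?thesis by simp
  qed
  with h0 show ?thesis by blast
qed

lemma C1_test_uminus: "C1_test G \<phi> \<phi>t \<phi>y \<Longrightarrow> C1_test G (\<lambda>z. - \<phi> z) (\<lambda>z. - \<phi>t z) (\<lambda>z. - \<phi>y z)"
  unfolding C1_test_def
  by (auto intro!: continuous_on_minus derivative_eq_intros)

text \<open>Above the obstacle, a constant control that attains the Hamiltonian would make the test function,
  hence the value, decrease at a definite rate, while the running cost stays below the value for a
  short time. By the first half of dynamic programming the value cannot decrease then.\<close>

lemma value_subsolution:
  assumes G: "open G" "G \<subseteq> {0<..<horizon M} \<times> UNIV"
  shows "viscosity_subsolution M G (value_fun M)"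
  unfolding viscosity_subsolution_def
proof (intro allI impI, elim conjE)
  fix \<phi> \<phi>t \<phi>y t y
  assume C1: "C1_test G \<phi> \<phi>t \<phi>y" and z0: "(t, y) \<in> G"
    and max: "local_max_at (\<lambda>z. value_fun M (fst z) (snd z) - \<phi> z) (t, y)"
  have t: "0 \<le> t" "t < horizon M" using G z0 by auto
  let ?v = "value_fun M"
  show "min (- \<phi>t (t, y) + hamiltonian M y (\<phi>y (t, y))) (?v t y - g_fun M y) \<le> 0"
  proof (rule ccontr)
    assume "\<not> ?thesis"
    then have pos: "0 < - \<phi>t (t, y) + hamiltonian M y (\<phi>y (t, y))" and above: "g_fun M y < ?v t y"
      by auto
    obtain c where c: "c \<in> controls M" "- (dyn M y c \<bullet> \<phi>y (t, y)) = hamiltonian M y (\<phi>y (t, y))"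
      using hamiltonian_value(3) by blast
    define k where "k = - \<phi>t (t, y) + hamiltonian M y (\<phi>y (t, y))"
    have k: "0 < k" using pos by (simp add: k_def)
    obtain h1 where h1: "0 < h1" "\<And>h \<omega>. h \<in> {0<..h1} \<Longrightarrow> \<omega> \<in> control_funs M \<Longrightarrow> (\<forall>s\<ge>0. \<omega> s \<in> {c}) \<Longrightarrow>
        - \<phi> (t, y) + k / 2 * h \<le> - \<phi> (t + h, traj M t y \<omega> (t + h))"
      using test_function_increases[OF C1_test_uminus[OF C1] G(1) z0 t k, of "{c}"] c
      by (auto simp: k_def)
    obtain d where d: "0 < d" "\<And>z. dist z (t, y) < d \<Longrightarrow> ?v (fst z) (snd z) - \<phi> z \<le> ?v t y - \<phi> (t, y)"
      using max unfolding local_max_at_def eventually_nhds_metric by auto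
    \<comment> \<open>Within distance \<open>m\<close> of \<open>y\<close> the obstacle stays below the midpoint of \<open>g_fun M y\<close> and the value.\<close>
    define m where "m = (?v t y - g_fun M y) / (2 * (1 + Lip))"
    have m: "0 < m" using above Lip_nonneg by (simp add: m_def)
    have Lm: "Lip * m \<le> (?v t y - g_fun M y) / 2"
      using above Lip_nonneg by (simp add: m_def field_simps)
    obtain h2 where h2: "0 < h2" "t + h2 \<le> horizon M"
      "\<And>h \<omega>. h \<in> {0..h2} \<Longrightarrow> \<omega> \<in> control_funs M \<Longrightarrow> dist (t + h, traj M t y \<omega> (t + h)) (t, y) < min d m"
      using trajectories_stay_near[OF t, of "min d m" y] d(1) m by (metis min_less_iff_conj)
    define h where "h = min h1 h2"
    have h: "h \<in> {0<..h1}" "h \<in> {0..h2}" "t \<le> t + h" "t + h \<le> horizon M"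
      using h1(1) h2 by (auto simp: h_def)
    let ?\<omega> = "\<lambda>_::real. c"
    let ?X = "traj M t y ?\<omega>"
    have w: "?\<omega> \<in> control_funs M" using c(1) by (rule constant_control)
    have "?v (t + h) (?X (t + h)) - \<phi> (t + h, ?X (t + h)) \<le> ?v t y - \<phi> (t, y)"
      using d(2)[of "(t + h, ?X (t + h))"] h2(3)[OF h(2) w] by simp
    then have later: "?v (t + h) (?X (t + h)) \<le> ?v t y - k / 2 * h"
      using h1(2)[OF h(1) w] by simp
    have run: "g_fun M (?X r) \<le> (?v t y + g_fun M y) / 2" if "t \<le> r" "r \<le> t + h" for r
    proof -
      have "dist (r, ?X r) (t, y) < m"
        using h2(3)[OF _ w, of "r - t"] that h by auto
      then have "norm (?X r - y) \<le> m"
        using dist_snd_le[of "(r, ?X r)" "(t, y)"] by (simp add: dist_norm)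
      then have "Lip * norm (?X r - y) \<le> Lip * m" using Lip_nonneg by (rule mult_left_mono)
      then have "g_fun M (?X r) \<le> g_fun M y + (?v t y - g_fun M y) / 2"
        using g_lipschitz[of "?X r" y] Lm by linarith
      then show ?thesis by (simp add: field_simps)
    qed
    have "?v t y \<le> max (?v t y - k / 2 * h) ((?v t y + g_fun M y) / 2)"
      by (rule value_le_along[OF w t(1) h(3,4)]) (use later run in \<open>auto simp: le_max_iff_disj\<close>)
    moreover have "0 < k / 2 * h" using k h by simp
    ultimately show False using above by (simp add: le_max_iff_disj)
  qed
qed

text \<open>If the inequality failed, the test function, hence the value, would increase at a definite rate along
  every trajectory, uniformly in the control. This contradicts the second half of dynamic programming.\<close>

lemma value_supersolution:
  assumes G: "open G" "G \<subseteq> {0<..<horizon M} \<times> UNIV"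
  shows "viscosity_supersolution M G (value_fun M)"
  unfolding viscosity_supersolution_def
proof (intro allI impI, elim conjE)
  fix \<phi> \<phi>t \<phi>y t y
  assume C1: "C1_test G \<phi> \<phi>t \<phi>y" and z0: "(t, y) \<in> G"
    and min: "local_min_at (\<lambda>z. value_fun M (fst z) (snd z) - \<phi> z) (t, y)"
  have t: "0 \<le> t" "t < horizon M" using G z0 by auto
  let ?v = "value_fun M"
  have "0 \<le> - \<phi>t (t, y) + hamiltonian M y (\<phi>y (t, y))"
  proof (rule ccontr)
    define k where "k = \<phi>t (t, y) - hamiltonian M y (\<phi>y (t, y))"
    assume "\<not> ?thesis"
    then have k: "0 < k" by (simp add: k_def)
    have W: "k \<le> \<phi>t (t, y) + dyn M y c \<bullet> \<phi>y (t, y)" if "c \<in> controls M" for c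
      using hamiltonian_value(2)[OF that, of y "\<phi>y (t, y)"] by (simp add: k_def)
    obtain h1 where h1: "0 < h1" "\<And>h \<omega>. h \<in> {0<..h1} \<Longrightarrow> \<omega> \<in> control_funs M \<Longrightarrow>
        (\<forall>s\<ge>0. \<omega> s \<in> controls M) \<Longrightarrow> \<phi> (t, y) + k / 2 * h \<le> \<phi> (t + h, traj M t y \<omega> (t + h))"
      using test_function_increases[OF C1 G(1) z0 t k W] by (metis (no_types, lifting))
    obtain d where d: "0 < d" "\<And>z. dist z (t, y) < d \<Longrightarrow> ?v t y - \<phi> (t, y) \<le> ?v (fst z) (snd z) - \<phi> z"
      using min unfolding local_min_at_def eventually_nhds_metric by auto
    obtain h2 where h2: "0 < h2" "t + h2 \<le> horizon M"
      "\<And>h \<omega>. h \<in> {0..h2} \<Longrightarrow> \<omega> \<in> control_funs M \<Longrightarrow> dist (t + h, traj M t y \<omega> (t + h)) (t, y) < d"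
      using trajectories_stay_near[OF t d(1), of y] by metis
    define h where "h = min h1 h2"
    have h: "h \<in> {0<..h1}" "h \<in> {0..h2}" "t \<le> t + h" "t + h \<le> horizon M" "0 < h"
      using h1(1) h2 by (auto simp: h_def)
    have "?v t y < ?v t y + k / 4 * h" using k h by simp
    from value_less_along[OF this t(1) h(3,4)] obtain \<omega> where
      w: "\<omega> \<in> control_funs M" and le: "?v (t + h) (traj M t y \<omega> (t + h)) \<le> ?v t y + k / 4 * h"
      by metis
    have "\<forall>s\<ge>0. \<omega> s \<in> controls M" using w by (simp add: control_funs_def)
    note inc = h1(2)[OF h(1) w this]
    have "?v t y - \<phi> (t, y) \<le> ?v (t + h) (traj M t y \<omega> (t + h)) - \<phi> (t + h, traj M t y \<omega> (t + h))"
      using d(2)[OF h2(3)[OF h(2) w]] by simp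
    with inc le have "k / 2 * h \<le> k / 4 * h" by linarith
    then show False using k h by simp
  qed
  moreover have "g_fun M y \<le> ?v t y"
    using t by (intro obstacle_le_value) auto
  ultimately show "0 \<le> min (- \<phi>t (t, y) + hamiltonian M y (\<phi>y (t, y))) (?v t y - g_fun M y)"
    by simp
qed

lemma value_hjb_solution: "hjb_solution M D (value_fun M)"
proof -
  have "open ({0<..<horizon M} \<times> interior D)" "{0<..<horizon M} \<times> interior D \<subseteq> {0<..<horizon M} \<times> UNIV"
    by (auto intro: open_Times)
  then show ?thesis
    using continuous_on_value value_subsolution value_supersolution
    by (simp add: hjb_solution_def value_fun_def)
qed

end

section \<open>Comparison of sub- and supersolutions\<close>

text \<open>The maximum of the doubled function is at least that of \<open>F - V\<close>, taken on the diagonal. This bounds the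
  penalty, so the maximizers approach the diagonal; in the limit they maximize \<open>F - V\<close>, which leaves
  nothing for the penalty.\<close>

lemma doubling_of_variables:
  fixes F V :: "'a::metric_space \<Rightarrow> real"
  assumes K: "compact K" "K \<noteq> {}" and F: "continuous_on K F" and V: "continuous_on K V"
  shows "\<exists>(c :: nat \<Rightarrow> real) a b z. (\<forall>n. 0 \<le> c n \<and> a n \<in> K \<and> b n \<in> K) \<and>
    (\<forall>n. \<forall>x\<in>K. \<forall>y\<in>K. F x - V y - c n * (dist x y)\<^sup>2 \<le> F (a n) - V (b n) - c n * (dist (a n) (b n))\<^sup>2) \<and>
    a \<longlonglongrightarrow> z \<and> b \<longlonglongrightarrow> z \<and> (\<lambda>n. c n * (dist (a n) (b n))\<^sup>2) \<longlonglongrightarrow> 0 \<and>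
    z \<in> K \<and> (\<forall>x\<in>K. F x - V x \<le> F z - V z)"
proof -
  have KK: "compact (K \<times> K)" "K \<times> K \<noteq> {}" using K by (auto intro: compact_Times)
  have FV: "continuous_on (K \<times> K) (\<lambda>p. F (fst p) - V (snd p) - real n * (dist (fst p) (snd p))\<^sup>2)" for n
    by (intro continuous_intros continuous_on_compose2[OF F] continuous_on_compose2[OF V]) auto
  have "\<forall>n. \<exists>p\<in>K \<times> K. \<forall>q\<in>K \<times> K. F (fst q) - V (snd q) - real n * (dist (fst q) (snd q))\<^sup>2
      \<le> F (fst p) - V (snd p) - real n * (dist (fst p) (snd p))\<^sup>2"
    using continuous_attains_sup[OF KK FV] by blast
  then obtain p where p: "\<And>n. p n \<in> K \<times> K"
    "\<And>n q. q \<in> K \<times> K \<Longrightarrow> F (fst q) - V (snd q) - real n * (dist (fst q) (snd q))\<^sup>2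
      \<le> F (fst (p n)) - V (snd (p n)) - real n * (dist (fst (p n)) (snd (p n)))\<^sup>2"
    by metis
  obtain l r where l: "l \<in> K \<times> K" "strict_mono r" "(p \<circ> r) \<longlonglongrightarrow> l"
    using KK(1) p(1) unfolding compact_def by metis
  define a where "a n = fst (p (r n))" for n
  define b where "b n = snd (p (r n))" for n
  define c where "c n = real (r n)" for n
  have ab: "a n \<in> K" "b n \<in> K" for n
    using p(1)[of "r n"] by (auto simp: a_def b_def mem_Times_iff)
  have max: "F x - V y - c n * (dist x y)\<^sup>2 \<le> F (a n) - V (b n) - c n * (dist (a n) (b n))\<^sup>2"
    if "x \<in> K" "y \<in> K" for n x y
    using p(2)[of "(x, y)" "r n"] that by (simp add: a_def b_def c_def)
  have lim: "a \<longlonglongrightarrow> fst l" "b \<longlonglongrightarrow> snd l"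
    using tendsto_fst[OF l(3)] tendsto_snd[OF l(3)] by (simp_all add: a_def[abs_def] b_def[abs_def] o_def)
  have lK: "fst l \<in> K" "snd l \<in> K" using l(1) by auto
  obtain m where m: "m \<in> K" "\<And>x. x \<in> K \<Longrightarrow> F x - V x \<le> F m - V m"
    using continuous_attains_sup[OF K continuous_on_diff[OF F V]] by blast
  \<comment> \<open>The diagonal point \<open>(m, m)\<close> is a competitor without penalty.\<close>
  have pen: "c n * (dist (a n) (b n))\<^sup>2 \<le> F (a n) - V (b n) - (F m - V m)" for n
    using max[OF m(1) m(1), of n] by simp
  have lim_FV: "(\<lambda>n. F (a n) - V (b n)) \<longlonglongrightarrow> F (fst l) - V (snd l)"
    by (intro tendsto_diff continuous_on_tendsto_compose[OF F] continuous_on_tendsto_compose[OF V] lim lK)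
       (auto simp: ab)
  have eq: "fst l = snd l"
  proof -
    obtain f where f: "\<And>x. x \<in> K \<Longrightarrow> F x \<le> F f" using continuous_attains_sup[OF K F] by blast
    obtain w where w: "\<And>x. x \<in> K \<Longrightarrow> V w \<le> V x" using continuous_attains_inf[OF K V] by blast
    define Q where "Q = F f - V w - (F m - V m)"
    have Q: "(dist (a n) (b n))\<^sup>2 \<le> Q / real n" if "n > 0" for n
    proof -
      have "real n * (dist (a n) (b n))\<^sup>2 \<le> c n * (dist (a n) (b n))\<^sup>2"
        unfolding c_def using strict_mono_imp_increasing[OF l(2), of n] by (intro mult_right_mono) auto
      also have "\<dots> \<le> Q"
        using pen[of n] f[OF ab(1), of n] w[OF ab(2), of n] by (simp add: Q_def)
      finally show ?thesis using that by (simp add: field_simps)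
    qed
    have "(\<lambda>n. (dist (a n) (b n))\<^sup>2) \<longlonglongrightarrow> 0"
    proof (rule tendsto_sandwich[OF _ _ tendsto_const lim_const_over_n[of Q]])
      show "\<forall>\<^sub>F n in sequentially. (dist (a n) (b n))\<^sup>2 \<le> Q / real n"
        using eventually_gt_at_top[of 0] by eventually_elim (rule Q)
    qed auto
    moreover have "(\<lambda>n. (dist (a n) (b n))\<^sup>2) \<longlonglongrightarrow> (dist (fst l) (snd l))\<^sup>2"
      by (intro tendsto_power tendsto_dist lim)
    ultimately have "(dist (fst l) (snd l))\<^sup>2 = 0" using LIMSEQ_unique by blast
    then show ?thesis by simp
  qed
  have ub: "(\<lambda>n. F (a n) - V (b n) - (F m - V m)) \<longlonglongrightarrow> F (fst l) - V (snd l) - (F m - V m)"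
    by (intro tendsto_diff lim_FV tendsto_const)
  have nn: "0 \<le> F (a n) - V (b n) - (F m - V m)" for n
    using order_trans[OF _ pen[of n], of 0] by (simp add: c_def)
  have "0 \<le> F (fst l) - V (snd l) - (F m - V m)"
    using LIMSEQ_le_const[OF ub, of 0] nn by blast
  with m(2)[OF lK(1)] eq have opt: "F (fst l) - V (fst l) = F m - V m" by simp
  have "(\<lambda>n. c n * (dist (a n) (b n))\<^sup>2) \<longlonglongrightarrow> 0"
  proof (rule tendsto_sandwich[OF _ _ tendsto_const])
    show "(\<lambda>n. F (a n) - V (b n) - (F m - V m)) \<longlonglongrightarrow> 0"
      using ub opt eq by simp
  qed (use pen in \<open>auto simp: c_def\<close>)
  then show ?thesis
    using ab max lim lK m(2) opt eq
    by (intro exI[of _ c] exI[of _ a] exI[of _ b] exI[of _ "fst l"]) (auto simp: c_def)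
qed

lemma C1_test_add:
  assumes "C1_test G \<phi> \<phi>t \<phi>y" "C1_test G \<psi> \<psi>t \<psi>y"
  shows "C1_test G (\<lambda>z. \<phi> z + \<psi> z) (\<lambda>z. \<phi>t z + \<psi>t z) (\<lambda>z. \<phi>y z + \<psi>y z)"
  using assms unfolding C1_test_def
  by (auto intro!: continuous_on_add derivative_eq_intros simp: inner_add_left algebra_simps)

lemma C1_test_time: "C1_test G (\<lambda>z. d * (s - fst z)) (\<lambda>z. - d) (\<lambda>z. 0)"
  unfolding C1_test_def by (auto intro!: continuous_intros derivative_eq_intros)

lemma C1_test_square_dist:
  "C1_test G (\<lambda>z. c * (dist z w)\<^sup>2) (\<lambda>z. 2 * c * (fst z - fst w)) (\<lambda>z. (2 * c) *\<^sub>R (snd z - snd w))"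
  unfolding C1_test_def dist_norm power2_norm_eq_inner
  by (auto intro!: continuous_intros derivative_eq_intros
      simp: inner_prod_def inner_commute algebra_simps)

lemma has_real_derivative_square_pos_part:
  "((\<lambda>x. (max x 0)\<^sup>2) has_real_derivative 2 * max x 0) (at x)" for x :: real
proof -
  consider "x > 0" | "x < 0" | "x = 0" by linarith
  then show ?thesis
  proof cases
    case 1
    have "((\<lambda>x. x\<^sup>2) has_real_derivative 2 * x) (at x)"
      by (auto intro!: derivative_eq_intros)
    from has_field_derivative_transform_within_open[OF this, of "{0<..}"] 1 show ?thesis by auto
  next
    case 2
    have "((\<lambda>x. 0) has_real_derivative 0) (at x)" by simp
    from has_field_derivative_transform_within_open[OF this, of "{..<0}"] 2 show ?thesis by auto
  next
    case 3
    have "((\<lambda>h::real. (max h 0)\<^sup>2 / h) \<longlongrightarrow> 0) (at 0)"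
    proof (rule Lim_null_comparison)
      show "\<forall>\<^sub>F h in at (0::real). norm ((max h 0)\<^sup>2 / h) \<le> \<bar>h\<bar>"
        by (intro always_eventually allI) (auto simp: max_def power2_eq_square)
      show "((\<lambda>h::real. \<bar>h\<bar>) \<longlongrightarrow> 0) (at 0)"
        by (rule tendsto_rabs_zero) (rule tendsto_ident_at)
    qed
    with 3 show ?thesis by (simp add: has_field_derivative_iff)
  qed
qed

text \<open>Penalties must be defined and continuously differentiable everywhere, hence squares of positive
  parts rather than barriers that blow up.\<close>

lemma C1_test_square_pos_part:
  assumes "C1_test G \<phi> \<phi>t \<phi>y"
  shows "C1_test G (\<lambda>z. N * (max (\<phi> z - R) 0)\<^sup>2) (\<lambda>z. 2 * N * max (\<phi> z - R) 0 * \<phi>t z)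
    (\<lambda>z. (2 * N * max (\<phi> z - R) 0) *\<^sub>R \<phi>y z)"
  unfolding C1_test_def
proof (intro conjI ballI)
  have d: "(\<phi> has_derivative (\<lambda>h. \<phi>t z * fst h + \<phi>y z \<bullet> snd h)) (at z)" if "z \<in> G" for z
    using assms that by (auto simp: C1_test_def)
  then have c: "continuous_on G \<phi>"
    by (meson continuous_at_imp_continuous_on has_derivative_continuous)
  have cc: "continuous_on G \<phi>t" "continuous_on G \<phi>y"
    using assms by (auto simp: C1_test_def)
  show "continuous_on G (\<lambda>z. 2 * N * max (\<phi> z - R) 0 * \<phi>t z)"
    "continuous_on G (\<lambda>z. (2 * N * max (\<phi> z - R) 0) *\<^sub>R \<phi>y z)"
    by (intro continuous_intros c cc)+
  fix z assume z: "z \<in> G"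
  have "((\<lambda>z. \<phi> z - R) has_derivative (\<lambda>h. \<phi>t z * fst h + \<phi>y z \<bullet> snd h)) (at z)"
    using has_derivative_diff[OF d[OF z] has_derivative_const[of R]] by simp
  from has_derivative_mult_right[OF has_derivative_compose[OF this
    has_real_derivative_square_pos_part[unfolded has_field_derivative_def, of "\<phi> z - R"]], of N]
  show "((\<lambda>z. N * (max (\<phi> z - R) 0)\<^sup>2) has_derivative
      (\<lambda>h. 2 * N * max (\<phi> z - R) 0 * \<phi>t z * fst h + (2 * N * max (\<phi> z - R) 0) *\<^sub>R \<phi>y z \<bullet> snd h)) (at z)"
    by (simp add: algebra_simps)
qed

text \<open>The sublevel sets of this weight are compact in bounded time intervals. For large \<open>K\<close> trajectories
  do not leave them.\<close>

definition reach_weight :: "real \<Rightarrow> real \<times> state \<Rightarrow> real" where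
  "reach_weight K z = (1 + snd z \<bullet> snd z) * exp (- K * fst z)"

lemma C1_test_reach_weight:
  "C1_test G (reach_weight K) (\<lambda>z. - K * reach_weight K z) (\<lambda>z. (2 * exp (- K * fst z)) *\<^sub>R snd z)"
  unfolding C1_test_def reach_weight_def
  by (auto intro!: continuous_intros derivative_eq_intros simp: inner_commute algebra_simps)

lemma compact_reach_weight_sublevel:
  assumes "closed D"
  shows "compact {z \<in> {0..T} \<times> D. reach_weight K z \<le> R}"
proof -
  have cont: "continuous_on UNIV (reach_weight K)"
    unfolding reach_weight_def by (intro continuous_intros)
  have "closed {z. reach_weight K z \<le> R}"
    by (intro closed_Collect_le cont continuous_on_const)
  moreover have "closed ({0..T} \<times> D)" using assms by (intro closed_Times) auto
  moreover have "{z \<in> {0..T} \<times> D. reach_weight K z \<le> R} = ({0..T} \<times> D) \<inter> {z. reach_weight K z \<le> R}"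
    by auto
  ultimately have cl: "closed {z \<in> {0..T} \<times> D. reach_weight K z \<le> R}" by (simp add: closed_Int)
  have "{z \<in> {0..T} \<times> D. reach_weight K z \<le> R} \<subseteq> {0..T} \<times> cball 0 (1 + R * exp (\<bar>K\<bar> * T))"
  proof
    fix z assume z: "z \<in> {z \<in> {0..T} \<times> D. reach_weight K z \<le> R}"
    have R: "0 \<le> R"
      using z order_trans[of 0 "reach_weight K z" R] by (simp add: reach_weight_def)
    have "1 + (norm (snd z))\<^sup>2 = reach_weight K z * exp (K * fst z)"
      by (simp add: reach_weight_def mult.assoc mult_exp_exp power2_norm_eq_inner)
    also have "\<dots> \<le> R * exp (\<bar>K\<bar> * T)"
    proof (rule mult_mono)
      have "K * fst z \<le> \<bar>K\<bar> * T"
        using z by (intro order_trans[OF mult_right_mono[of K "\<bar>K\<bar>"]] mult_left_mono) auto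
      then show "exp (K * fst z) \<le> exp (\<bar>K\<bar> * T)" by simp
    qed (use z R in auto)
    finally have "(norm (snd z))\<^sup>2 \<le> R * exp (\<bar>K\<bar> * T)" by simp
    moreover have "2 * norm (snd z) \<le> 1 + (norm (snd z))\<^sup>2"
      using sum_squares_bound[of 1 "norm (snd z)"] by simp
    moreover have "0 \<le> R * exp (\<bar>K\<bar> * T)" using R by simp
    ultimately have "norm (snd z) \<le> 1 + R * exp (\<bar>K\<bar> * T)" by linarith
    with z show "z \<in> {0..T} \<times> cball 0 (1 + R * exp (\<bar>K\<bar> * T))" by auto
  qed
  moreover have "bounded ({0..T} \<times> cball (0::state) (1 + R * exp (\<bar>K\<bar> * T)))"
    by (intro bounded_Times) auto
  ultimately show ?thesis
    using cl bounded_subset compact_eq_bounded_closed by blast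
qed

context control_problem
begin

text \<open>An upper bound for the logarithmic growth rate of \<open>1 + |X|\<^sup>2\<close> along trajectories.\<close>

definition growth_rate :: real where
  "growth_rate = 2 * speed_slope M + speed_offset M"

text \<open>The left-hand side is the derivative of the weight along a trajectory through \<open>z\<close> with control
  value \<open>c\<close>.\<close>

lemma reach_weight_decreases:
  assumes "c \<in> controls M"
  shows "- growth_rate * reach_weight growth_rate z
    + dyn M (snd z) c \<bullet> ((2 * exp (- growth_rate * fst z)) *\<^sub>R snd z) \<le> 0"
proof -
  let ?x = "norm (snd z)" and ?a = "speed_slope M" and ?m = "speed_offset M"
  have "2 * (dyn M (snd z) c \<bullet> snd z) \<le> 2 * ((?a * ?x + ?m) * ?x)"
    using norm_cauchy_schwarz[of "dyn M (snd z) c" "snd z"]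
      mult_right_mono[OF norm_dyn[OF assms, of "snd z"] norm_ge_zero[of "snd z"]] by linarith
  also have "\<dots> = 2 * ?a * ?x\<^sup>2 + ?m * (2 * ?x)" by (simp add: power2_eq_square algebra_simps)
  also have "\<dots> \<le> 2 * ?a * (1 + ?x\<^sup>2) + ?m * (1 + ?x\<^sup>2)"
    using sum_squares_bound[of 1 ?x] speed_slope_nonneg speed_offset_nonneg
    by (intro add_mono mult_left_mono) auto
  also have "\<dots> = growth_rate * (1 + snd z \<bullet> snd z)"
    by (simp add: growth_rate_def power2_norm_eq_inner algebra_simps)
  finally have "(2 * (dyn M (snd z) c \<bullet> snd z) - growth_rate * (1 + snd z \<bullet> snd z)) * exp (- growth_rate * fst z) \<le> 0"
    by (intro mult_nonpos_nonneg) auto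
  then show ?thesis by (simp add: reach_weight_def algebra_simps)
qed

text \<open>Both quadratic test functions have the same gradient \<open>(s, p)\<close>, so the two viscosity inequalities can be
  subtracted. What remains is the strictness \<open>d\<close> of \<open>\<psi>\<close> against the difference of the velocities at \<open>a\<close> and
  \<open>b\<close> paired with \<open>p\<close>, which is of the order of the penalty. If instead \<open>u\<close> does not exceed the obstacle at \<open>a\<close>, then
  \<open>v\<close> is at least the obstacle at \<open>b\<close>, and only the variation of the obstacle is left.\<close>

lemma doubled_viscosity_inequality:
  assumes sub: "viscosity_subsolution M G u" and super: "viscosity_supersolution M G v"
    and mem: "a \<in> G" "b \<in> G" and C1: "C1_test G \<psi> \<psi>t \<psi>y"
    and strict: "\<And>c. c \<in> controls M \<Longrightarrow> d \<le> - \<psi>t a - dyn M (snd a) c \<bullet> \<psi>y a"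
    and max: "local_max_at (\<lambda>z. u (fst z) (snd z) - (\<psi> z + k * (dist z b)\<^sup>2)) a"
    and min: "local_min_at (\<lambda>z. v (fst z) (snd z) - (- k) * (dist z a)\<^sup>2) b"
    and k: "0 \<le> k"
  shows "u (fst a) (snd a) - v (fst b) (snd b) \<le> Lip * dist a b \<or>
    d \<le> 2 * speed_slope M * (k * (dist a b)\<^sup>2)"
proof -
  define p where "p = (2 * k) *\<^sub>R (snd a - snd b)"
  define s where "s = 2 * k * (fst a - fst b)"
  have "min (- (\<psi>t a + s) + hamiltonian M (snd a) (\<psi>y a + p)) (u (fst a) (snd a) - g_fun M (snd a)) \<le> 0"
    using sub[unfolded viscosity_subsolution_def, rule_format,
        of "\<lambda>z. \<psi> z + k * (dist z b)\<^sup>2" _ _ "fst a" "snd a",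
        OF conjI[OF C1_test_add[OF C1 C1_test_square_dist]]] mem max
    by (simp add: p_def s_def)
  then have u: "u (fst a) (snd a) \<le> g_fun M (snd a) \<or>
      hamiltonian M (snd a) (\<psi>y a + p) \<le> \<psi>t a + s"
    by auto
  have "0 \<le> min (- s + hamiltonian M (snd b) p) (v (fst b) (snd b) - g_fun M (snd b))"
  proof -
    have "s = 2 * (- k) * (fst b - fst a)" "p = (2 * (- k)) *\<^sub>R (snd b - snd a)"
      by (simp_all add: p_def s_def algebra_simps)
    then show ?thesis
      using super[unfolded viscosity_supersolution_def, rule_format,
        of "\<lambda>z. (- k) * (dist z a)\<^sup>2" _ _ "fst b" "snd b",
        OF conjI[OF C1_test_square_dist]] mem min
      by simp
  qed
  then have v: "g_fun M (snd b) \<le> v (fst b) (snd b)" "s \<le> hamiltonian M (snd b) p"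
    by auto
  have ds: "norm (snd a - snd b) \<le> dist a b"
    using dist_snd_le[of a b] by (simp add: dist_norm)
  from u show ?thesis
  proof
    assume "u (fst a) (snd a) \<le> g_fun M (snd a)"
    then have "u (fst a) (snd a) - v (fst b) (snd b) \<le> Lip * norm (snd a - snd b)"
      using v(1) g_lipschitz[of "snd a" "snd b"] by linarith
    also have "\<dots> \<le> Lip * dist a b" using ds Lip_nonneg by (rule mult_left_mono)
    finally show ?thesis ..
  next
    assume H: "hamiltonian M (snd a) (\<psi>y a + p) \<le> \<psi>t a + s"
    obtain c where c: "c \<in> controls M" "- (dyn M (snd b) c \<bullet> p) = hamiltonian M (snd b) p"
      using hamiltonian_value(3) by blast
    let ?fa = "dyn M (snd a) c" and ?fb = "dyn M (snd b) c"
    have "- (?fa \<bullet> (\<psi>y a + p)) \<le> \<psi>t a + s"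
      using hamiltonian_value(2)[OF c(1), of "snd a" "\<psi>y a + p"] H by linarith
    then have "d \<le> (?fa - ?fb) \<bullet> p"
      using strict[OF c(1)] v(2) c(2) by (simp add: inner_add_right inner_diff_left)
    also have "\<dots> \<le> norm (?fa - ?fb) * norm p" by (rule norm_cauchy_schwarz)
    also have "\<dots> \<le> (speed_slope M * dist a b) * (2 * k * dist a b)"
    proof (rule mult_mono)
      show "norm (?fa - ?fb) \<le> speed_slope M * dist a b"
        unfolding dyn_diff
        using norm_lin_part[of M "snd a - snd b"] mult_left_mono[OF ds speed_slope_nonneg[of M]]
        by linarith
      show "norm p \<le> 2 * k * dist a b"
        using mult_left_mono[OF ds, of "2 * k"] k by (simp add: p_def)
    qed (use speed_slope_nonneg in auto)
    also have "\<dots> = 2 * speed_slope M * (k * (dist a b)\<^sup>2)" by (simp add: power2_eq_square)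
    finally show ?thesis ..
  qed
qed

text \<open>The penalty \<open>\<psi>\<close> is at most half the gap at \<open>(t0, y0)\<close>, so \<open>u - v - \<psi>\<close> has a positive maximum over the
  compact set \<open>K\<close>. This maximum lies in the interior of \<open>K\<close>: at time \<open>0\<close> and at the rim of the
  sublevel set \<open>\<psi>\<close> is at least the bound \<open>B\<close> of \<open>u - v\<close>, and at the terminal time and the frontier \<open>u \<le> v\<close>
  holds. Maximizers of the doubled function converge to it, and eventually contradict the doubled
  viscosity inequality.\<close>

lemma comparison_interior_time:
  fixes D :: "state set" and u v :: "real \<Rightarrow> state \<Rightarrow> real"
  assumes D: "closed D"
    and cu: "continuous_on ({0..horizon M} \<times> D) (\<lambda>z. u (fst z) (snd z))"
    and cv: "continuous_on ({0..horizon M} \<times> D) (\<lambda>z. v (fst z) (snd z))"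
    and sub: "viscosity_subsolution M ({0<..<horizon M} \<times> interior D) u"
    and super: "viscosity_supersolution M ({0<..<horizon M} \<times> interior D) v"
    and terminal: "\<And>y. y \<in> D \<Longrightarrow> u (horizon M) y \<le> v (horizon M) y"
    and lateral: "\<And>t y. t \<in> {0..horizon M} \<Longrightarrow> y \<in> frontier D \<Longrightarrow> u t y \<le> v t y"
    and t0: "0 < t0" "t0 < horizon M" and y0: "y0 \<in> D"
  shows "u t0 y0 \<le> v t0 y0"
proof (rule ccontr)
  let ?T = "horizon M" and ?G = "{0<..<horizon M} \<times> interior D"
  let ?u = "\<lambda>z. u (fst z) (snd z)" and ?v = "\<lambda>z. v (fst z) (snd z)" and ?r = "reach_weight growth_rate"
  assume "\<not> ?thesis"
  then have gap: "v t0 y0 < u t0 y0" by simp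
  define R where "R = ?r (t0, y0)"
  define K where "K = {z \<in> {0..?T} \<times> D. ?r z \<le> R + 1}"
  have K: "compact K" unfolding K_def by (rule compact_reach_weight_sublevel[OF D])
  have mem0: "(t0, y0) \<in> K" using t0 y0 by (simp add: K_def R_def)
  have KD: "K \<subseteq> {0..?T} \<times> D" by (auto simp: K_def)
  have cuK: "continuous_on K ?u" and cvK: "continuous_on K ?v"
    using continuous_on_subset[OF cu KD] continuous_on_subset[OF cv KD] .
  obtain B where B: "0 < B" "\<And>z. z \<in> K \<Longrightarrow> ?u z - ?v z \<le> B"
  proof -
    obtain x where "\<And>z. z \<in> K \<Longrightarrow> ?u z - ?v z \<le> ?u x - ?v x"
      using continuous_attains_sup[OF K _ continuous_on_diff[OF cuK cvK]] mem0 by blast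
    then show thesis using that[of "max 1 (?u x - ?v x)"] by (simp add: le_max_iff_disj)
  qed
  define d where "d = (u t0 y0 - v t0 y0) / (2 * ?T)"
  have d: "0 < d" using gap horizon_pos by (simp add: d_def)
  \<comment> \<open>The first summand serves the rim of the sublevel set, the second one the time \<open>0\<close>.\<close>
  define N where "N = B + B / t0\<^sup>2"
  have N: "B \<le> N" "B \<le> N * t0\<^sup>2" "0 \<le> N"
    using B(1) t0(1) by (auto simp: N_def distrib_right)
  \<comment> \<open>The neutral terms (\<open>1 *\<close>, \<open>- 0\<close>, \<open>0 +\<close>) give the three functions the exact shape that the rules
      for test functions produce.\<close>
  define \<psi> where "\<psi> z = d * (?T - fst z) + N * (max (1 * (t0 - fst z) - 0) 0)\<^sup>2 + N * (max (?r z - R) 0)\<^sup>2" for z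
  define \<psi>t where "\<psi>t z = - d + 2 * N * max (1 * (t0 - fst z) - 0) 0 * (- 1)
      + 2 * N * max (?r z - R) 0 * (- growth_rate * ?r z)" for z
  define \<psi>y where "\<psi>y z = 0 + (2 * N * max (1 * (t0 - fst z) - 0) 0) *\<^sub>R (0 :: state)
      + (2 * N * max (?r z - R) 0) *\<^sub>R ((2 * exp (- growth_rate * fst z)) *\<^sub>R snd z)" for z
  have C1: "C1_test A \<psi> \<psi>t \<psi>y" for A
    unfolding \<psi>_def \<psi>t_def \<psi>y_def
    by (intro C1_test_add C1_test_time C1_test_square_pos_part C1_test_reach_weight)
  have strict: "d \<le> - \<psi>t z - dyn M (snd z) c \<bullet> \<psi>y z" if "c \<in> controls M" for c z
  proof -
    have "0 \<le> 2 * N * max (t0 - fst z) 0" using N(3) by simp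
    moreover have "(2 * N * max (?r z - R) 0) * (- growth_rate * ?r z
        + dyn M (snd z) c \<bullet> ((2 * exp (- growth_rate * fst z)) *\<^sub>R snd z)) \<le> 0"
      by (rule mult_nonneg_nonpos[OF _ reach_weight_decreases[OF that]]) (use N(3) in auto)
    ultimately show ?thesis
      unfolding \<psi>t_def \<psi>y_def by (simp add: algebra_simps)
  qed
  have \<psi>: "0 \<le> \<psi> z" if "z \<in> K" for z
    using that N(3) d by (auto simp: \<psi>_def K_def)
  have "continuous_on UNIV ?r"
    unfolding reach_weight_def by (intro continuous_intros)
  then have cr: "continuous_on A ?r" for A by (rule continuous_on_subset) simp
  have c\<psi>: "continuous_on K (\<lambda>z. ?u z - \<psi> z)"
    unfolding \<psi>_def by (intro continuous_intros cuK cr)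
  obtain c a b z where seq: "\<forall>n. 0 \<le> c n \<and> a n \<in> K \<and> b n \<in> K"
    and max: "\<forall>n::nat. \<forall>x\<in>K. \<forall>y\<in>K. (?u x - \<psi> x) - ?v y - c n * (dist x y)\<^sup>2
        \<le> (?u (a n) - \<psi> (a n)) - ?v (b n) - c n * (dist (a n) (b n))\<^sup>2"
    and lim: "a \<longlonglongrightarrow> z" "b \<longlonglongrightarrow> z" "(\<lambda>n. c n * (dist (a n) (b n))\<^sup>2) \<longlonglongrightarrow> 0"
    and z: "z \<in> K" "\<forall>x\<in>K. (?u x - \<psi> x) - ?v x \<le> (?u z - \<psi> z) - ?v z"
    using doubling_of_variables[OF K _ c\<psi> cvK] mem0 by blast
  \<comment> \<open>The positive parts in \<open>\<psi>\<close> vanish at \<open>(t0, y0)\<close>.\<close>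
  have "d * ?T = (u t0 y0 - v t0 y0) / 2" using horizon_pos by (simp add: d_def)
  then have "\<psi> (t0, y0) \<le> (u t0 y0 - v t0 y0) / 2"
    using d t0 by (simp add: \<psi>_def R_def right_diff_distrib)
  then have pos: "\<psi> z < ?u z - ?v z"
    using z(2) mem0 gap by fastforce
  then have uv: "?v z < ?u z" using \<psi>[OF z(1)] by simp
  have zD: "0 \<le> fst z" "fst z \<le> ?T" "snd z \<in> D" "?r z \<le> R + 1"
    using z(1) by (auto simp: K_def)
  have "fst z \<noteq> ?T" using terminal[OF zD(3)] uv by auto
  moreover have "fst z \<noteq> 0"
  proof
    assume "fst z = 0"
    then have "N * t0\<^sup>2 \<le> \<psi> z"
      using t0 d N(3) horizon_pos by (simp add: \<psi>_def)
    then show False using pos B(2)[OF z(1)] N(2) by simp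
  qed
  moreover have "?r z \<noteq> R + 1"
  proof
    assume "?r z = R + 1"
    then have "N \<le> \<psi> z" using zD d N(3) by (simp add: \<psi>_def)
    then show False using pos B(2)[OF z(1)] N(1) by simp
  qed
  moreover have "snd z \<in> interior D"
    using lateral[of "fst z" "snd z"] uv zD D by (force simp: frontier_def)
  ultimately have zO: "z \<in> ?G \<inter> {z. ?r z < R + 1}"
    using zD by (auto simp: mem_Times_iff)
  define Op where "Op = ?G \<inter> {z. ?r z < R + 1}"
  have Op: "open Op" "Op \<subseteq> ?G" "Op \<subseteq> K"
    unfolding Op_def K_def using interior_subset[of D]
    by (auto intro!: open_Int open_Times open_Collect_less cr continuous_on_const)
  have "\<forall>\<^sub>F n in sequentially. a n \<in> Op" "\<forall>\<^sub>F n in sequentially. b n \<in> Op"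
    using topological_tendstoD[OF lim(1) Op(1)] topological_tendstoD[OF lim(2) Op(1)] zO
    by (auto simp: Op_def)
  moreover have "\<forall>\<^sub>F n in sequentially. 0 < ?u (a n) - ?v (b n) - Lip * dist (a n) (b n)"
  proof -
    have "(\<lambda>n. ?u (a n) - ?v (b n) - Lip * dist (a n) (b n)) \<longlonglongrightarrow> ?u z - ?v z - Lip * dist z z"
      by (intro tendsto_diff tendsto_mult tendsto_dist tendsto_const lim(1,2)
          continuous_on_tendsto_compose[OF cuK lim(1) z(1)] continuous_on_tendsto_compose[OF cvK lim(2) z(1)])
         (use seq in auto)
    then show ?thesis by (rule order_tendstoD) (use uv in simp)
  qed
  moreover have "\<forall>\<^sub>F n in sequentially. 2 * speed_slope M * (c n * (dist (a n) (b n))\<^sup>2) < d"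
    by (rule order_tendstoD(2)[OF tendsto_mult[OF tendsto_const lim(3)]]) (use d in simp)
  ultimately have "\<forall>\<^sub>F n in sequentially. False"
  proof eventually_elim
    case (elim n)
    have "local_max_at (\<lambda>x. ?u x - (\<psi> x + c n * (dist x (b n))\<^sup>2)) (a n)"
      unfolding local_max_at_def
    proof (rule eventually_mono[OF eventually_nhds_in_open[OF Op(1) elim(1)]])
      fix x assume "x \<in> Op"
      then show "?u x - (\<psi> x + c n * (dist x (b n))\<^sup>2) \<le> ?u (a n) - (\<psi> (a n) + c n * (dist (a n) (b n))\<^sup>2)"
        using max[rule_format, of x "b n" n] seq Op(3) by auto
    qed
    moreover have "local_min_at (\<lambda>y. ?v y - (- c n) * (dist y (a n))\<^sup>2) (b n)"
      unfolding local_min_at_def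
    proof (rule eventually_mono[OF eventually_nhds_in_open[OF Op(1) elim(2)]])
      fix y assume "y \<in> Op"
      then show "?v (b n) - (- c n) * (dist (b n) (a n))\<^sup>2 \<le> ?v y - (- c n) * (dist y (a n))\<^sup>2"
        using max[rule_format, of "a n" y n] seq Op(3) by (auto simp: dist_commute)
    qed
    ultimately show False
      using doubled_viscosity_inequality[OF sub super _ _ C1 strict, of "a n" "b n" "c n"] elim Op(2) seq
      by fastforce
  qed
  then show False by simp
qed

text \<open>The remaining times \<open>0\<close> and \<open>horizon M\<close> follow by continuity.\<close>

lemma comparison:
  fixes D :: "state set" and u v :: "real \<Rightarrow> state \<Rightarrow> real"
  assumes u: "hjb_solution M D u" and v: "hjb_solution M D v" and D: "closed D"
    and lateral: "\<And>t y. t \<in> {0..horizon M} \<Longrightarrow> y \<in> frontier D \<Longrightarrow> u t y \<le> v t y"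
    and t: "t \<in> {0..horizon M}" and y: "y \<in> D"
  shows "u t y \<le> v t y"
proof -
  let ?T = "horizon M"
  have cu: "continuous_on ({0..?T} \<times> D) (\<lambda>z. u (fst z) (snd z))"
    and cv: "continuous_on ({0..?T} \<times> D) (\<lambda>z. v (fst z) (snd z))"
    using u v by (auto simp: hjb_solution_def)
  have "u s y - v s y \<le> 0" if "s \<in> {0<..<?T}" for s
    using comparison_interior_time[OF D cu cv _ _ _ lateral, of s y] u v that y
    by (simp add: hjb_solution_def)
  moreover have "continuous_on {0..?T} (\<lambda>s. u s y - v s y)"
  proof -
    have "continuous_on {0..?T} (\<lambda>s. (s, y))" "(\<lambda>s. (s, y)) ` {0..?T} \<subseteq> {0..?T} \<times> D"
      using y by (auto intro!: continuous_intros)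
    from continuous_on_diff[OF continuous_on_compose2[OF cu this] continuous_on_compose2[OF cv this]]
    show ?thesis by simp
  qed
  ultimately have "u t y - v t y \<le> 0"
    using continuous_le_on_closure[of "{0<..<?T}" "\<lambda>s. u s y - v s y" t 0] t horizon_pos by simp
  then show ?thesis by simp
qed

lemma hjb_solution_unique:
  assumes w: "hjb_solution M D w" and D: "closed D"
    and lateral: "\<And>t y. t \<in> {0..horizon M} \<Longrightarrow> y \<in> frontier D \<Longrightarrow> w t y = value_fun M t y"
    and "t \<in> {0..horizon M}" "y \<in> D"
  shows "w t y = value_fun M t y"
  using comparison[OF w value_hjb_solution D _ assms(4,5)]
    comparison[OF value_hjb_solution w D _ assms(4,5)] lateral
  by (intro antisym) auto

end

section \<open>The Hamilton-Jacobi-Bellman characterisation\<close>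

theorem theorem4p6:
  fixes M :: model
  assumes "dem_a M > 0" "dem_b M > 0" "dem_c M > 0" "rho M > 0"
    and "beta M \<ge> 0" "gamma M \<ge> 0" "theta M \<ge> 0" "alpha M > gamma M"
    and "qual M \<ge> 0"
    and "0 \<le> p_lo M" "p_lo M \<le> p_hi M" "0 \<le> U_max M"
    and "horizon M > 0"
    and "\<And>\<omega>. \<omega> \<in> controls M \<Longrightarrow> demand M \<omega> \<ge> 0"
    and "0 \<le> P_min M" "P_min M \<le> P_max M" "0 \<le> I_min M" "I_min M \<le> I_max M"
    and "P_min M \<le> P_tgt M" "P_tgt M \<le> P_max M" "I_min M \<le> I_tgt M" "I_tgt M \<le> I_max M"
    and "\<exists>L. L-lipschitz_on UNIV (g_fun M)" "\<exists>L. L-lipschitz_on UNIV (v0_fun M)"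
  shows
    "(\<forall>P I \<zeta>1 \<zeta>2.
        (\<forall>\<omega>\<in>controls M. - (dyn M (P, I) \<omega> \<bullet> (\<zeta>1, \<zeta>2)) \<le> hamiltonian M (P, I) (\<zeta>1, \<zeta>2)) \<and>
        (\<exists>\<omega>\<in>controls M. - (dyn M (P, I) \<omega> \<bullet> (\<zeta>1, \<zeta>2)) = hamiltonian M (P, I) (\<zeta>1, \<zeta>2)) \<and>
        hamiltonian M (P, I) (\<zeta>1, \<zeta>2) =
          (theta M * I - P) * \<zeta>2 + (beta M * I + gamma M * P) * \<zeta>1 +
          max ((\<zeta>2 - alpha M * \<zeta>1) * rho M * U_max M *
               (dem_a M - dem_b M * p_lo M + dem_c M * qual M)) 0) \<and>
     hjb_solution M Omega (value_fun M) \<and>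
     (\<forall>w. hjb_solution M Omega w \<and>
           (\<forall>t\<in>{0..horizon M}. \<forall>y\<in>frontier Omega. w t y = value_fun M t y) \<longrightarrow>
           (\<forall>t\<in>{0..horizon M}. \<forall>y\<in>Omega. w t y = value_fun M t y)) \<and>
     hjb_solution M UNIV (value_fun M) \<and>
     (\<forall>w. hjb_solution M UNIV w \<longrightarrow>
           (\<forall>t\<in>{0..horizon M}. \<forall>y. w t y = value_fun M t y))"
proof -
  obtain L1 L2 where L: "L1-lipschitz_on UNIV (g_fun M)" "L2-lipschitz_on UNIV (v0_fun M)"
    using assms(23,24) by blast
  have Lip: "(max L1 L2)-lipschitz_on UNIV (g_fun M)" "(max L1 L2)-lipschitz_on UNIV (v0_fun M)"
    by (rule lipschitz_on_le[OF L(1)], simp, rule lipschitz_on_le[OF L(2)], simp)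
  interpret control_problem M "max L1 L2"
    by (intro control_problem.intro assms(2,4,11-14) Lip)
  have closed_Omega: "closed Omega" unfolding Omega_def by (intro closed_Times) auto
  show ?thesis
  proof (intro conjI allI impI ballI)
    fix P I \<zeta>1 \<zeta>2
    show "- (dyn M (P, I) \<omega> \<bullet> (\<zeta>1, \<zeta>2)) \<le> hamiltonian M (P, I) (\<zeta>1, \<zeta>2)"
      if "\<omega> \<in> controls M" for \<omega>
      by (rule hamiltonian_value(2)[OF that])
    show "\<exists>\<omega>\<in>controls M. - (dyn M (P, I) \<omega> \<bullet> (\<zeta>1, \<zeta>2)) = hamiltonian M (P, I) (\<zeta>1, \<zeta>2)"
      by (rule hamiltonian_value(3))
    show "hamiltonian M (P, I) (\<zeta>1, \<zeta>2) =
        (theta M * I - P) * \<zeta>2 + (beta M * I + gamma M * P) * \<zeta>1 +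
        max ((\<zeta>2 - alpha M * \<zeta>1) * rho M * U_max M *
             (dem_a M - dem_b M * p_lo M + dem_c M * qual M)) 0"
      using hamiltonian_value(1)[of "(P, I)" "(\<zeta>1, \<zeta>2)"] by simp
  next
    show "hjb_solution M Omega (value_fun M)" "hjb_solution M UNIV (value_fun M)"
      by (rule value_hjb_solution)+
  next
    fix w t y
    assume "hjb_solution M Omega w \<and> (\<forall>t\<in>{0..horizon M}. \<forall>y\<in>frontier Omega. w t y = value_fun M t y)"
      and "t \<in> {0..horizon M}" "y \<in> Omega"
    then show "w t y = value_fun M t y"
      using hjb_solution_unique[OF _ closed_Omega, of w t y] by blast
  next
    fix w t y
    assume "hjb_solution M UNIV w" "t \<in> {0..horizon M}"
    then show "w t y = value_fun M t y"
      using hjb_solution_unique[of UNIV w t y] by simp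
  qed
qed

end
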